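(* Let $\eta\in\mathbb{R}$ and $\ell>-3/2$, with the exception that $\ell\neq-1$ if $\eta\neq0$. Then the following inequalities hold: $$|F_{\ell,\eta}(x)|^2<\frac{x}{x-\eta-\sqrt{(\ell+1)^2+\eta^2}},\qquad |F_{\ell,\eta}'(x)|^2<1+\frac{\sqrt{(\ell+1)^2+\eta^2}-\eta}{x},$$ for $x>\eta+\sqrt{(\ell+1)^2+\eta^2}>0$. In particular, $$|F_{\ell,\eta}(\beta)|^2>\frac{\beta}{\beta-\eta+\sqrt{(\ell+1)^2+\eta^2}},\qquad |F_{\ell,\eta}'(\alpha)|^2>1-\frac{\sqrt{(\ell+1)^2+\eta^2}+\eta}{\alpha},$$ where $\alpha,\beta$ denote any positive zeros of $F_{\ell,\eta},F_{\ell,\eta}'$, respectively.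
   Context: For real $\eta$ and $\ell$, the regular Coulomb wave function is, for $x>0$, $$F_{\ell,\eta}(x)=C_{\ell,\eta}\,x^{\ell+1}\phi_{\ell,\eta}(x),\qquad C_{\ell,\eta}=\frac{2^{\ell}e^{-\pi\eta/2}|\Gamma(\ell+1+i\eta)|}{\Gamma(2\ell+2)},$$ $$\phi_{\ell,\eta}(x)=e^{-ix}\,{}_1F_1(\ell+1-i\eta,\,2\ell+2;\,2ix),\qquad {}_1F_1(a,b;z)=\sum_{k\ge0}\frac{(a)_k}{(b)_k}\frac{z^k}{k!},$$ where $(a)_k=\Gamma(a+k)/\Gamma(a)$ is the Pochhammer symbol. In the case $(\ell,\eta)=(-1,0)$ these expressions are read as limits as $\ell\to-1^+$ with $\eta=0$. Primes denote derivatives with respect to $x$. *)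

theory Defs
  imports "HOL-Analysis.Analysis"
begin

definition kummer_1F1 :: "complex \<Rightarrow> complex \<Rightarrow> complex \<Rightarrow> complex" where
  "kummer_1F1 a b z = (\<Sum>k. pochhammer a k / pochhammer b k * (z ^ k / fact k))"

definition coulomb_C_raw :: "real \<Rightarrow> real \<Rightarrow> real" where
  "coulomb_C_raw l \<eta> =
     2 powr l * exp (- pi * \<eta> / 2) * cmod (Gamma (Complex (l + 1) \<eta>)) / Gamma (2 * l + 2)"

definition coulomb_phi_raw :: "real \<Rightarrow> real \<Rightarrow> real \<Rightarrow> complex" where
  "coulomb_phi_raw l \<eta> x =
     exp (- \<i> * of_real x) *
     kummer_1F1 (Complex (l + 1) (- \<eta>)) (of_real (2 * l + 2)) (2 * \<i> * of_real x)"

text \<open>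
  At \<open>l = -1\<close> the second parameter \<open>2 * l + 2\<close> is a pole of Gamma and a forbidden
  denominator parameter of the series; for \<open>\<eta> = 0\<close> both factors are read as their
  limits as \<open>l\<close> tends to \<open>-1\<close> from the right.  For \<open>\<eta> \<noteq> 0\<close> the value at \<open>l = -1\<close> is
  meaningless and this pair must be excluded.
\<close>

definition coulomb_C :: "real \<Rightarrow> real \<Rightarrow> real" where
  "coulomb_C l \<eta> =
     (if l = -1 \<and> \<eta> = 0 then Lim (at_right (-1)) (\<lambda>l'. coulomb_C_raw l' 0)
      else coulomb_C_raw l \<eta>)"

definition coulomb_phi :: "real \<Rightarrow> real \<Rightarrow> real \<Rightarrow> complex" where
  "coulomb_phi l \<eta> x =
     (if l = -1 \<and> \<eta> = 0 then Lim (at_right (-1)) (\<lambda>l'. coulomb_phi_raw l' 0 x)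
      else coulomb_phi_raw l \<eta> x)"

text \<open>
  The regular Coulomb wave function, meaningful for \<open>x > 0\<close>.  It takes real values, but it
  is given by a complex expression and is therefore complex-valued here; its derivative
  with respect to the real variable \<open>x\<close> is a \<^const>\<open>vector_derivative\<close>.
\<close>

definition coulomb_F :: "real \<Rightarrow> real \<Rightarrow> real \<Rightarrow> complex" where
  "coulomb_F l \<eta> x = of_real (coulomb_C l \<eta>) * of_real (x powr (l + 1)) * coulomb_phi l \<eta> x"

definition coulomb_F' :: "real \<Rightarrow> real \<Rightarrow> real \<Rightarrow> complex" where
  "coulomb_F' l \<eta> x = vector_derivative (coulomb_F l \<eta>) (at x)"

end

theory Submission
  imports Defs "HOL-Complex_Analysis.Cauchy_Integral_Theorem"
begin

text \<open>
Write \<open>a = l + 1\<close> and \<open>R = sqrt (a\<^sup>2 + \<eta>\<^sup>2)\<close>.  The hypotheses exclude \<open>a = 0\<close>, and the function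
\<open>F\<close> is real and solves \<open>F'' = ((a\<^sup>2 - a) / x\<^sup>2 + 2 \<eta> / x - 1) F\<close>.  The idea is to follow the energy
\<open>E = F'\<^sup>2 + (1 - 2 \<eta> / x - a\<^sup>2 / x\<^sup>2) F\<^sup>2\<close>, whose coefficient is not the one of the equation but the
one that factors as \<open>p m\<close> with \<open>p = 1 - (R + \<eta>) / x\<close> and \<open>m = 1 + (R - \<eta>) / x\<close>.  With this choice the
derivatives of \<open>E / m\<close> and of \<open>E / p\<close> are, up to constants of fixed sign, perfect squares of linear
combinations of \<open>F\<close> and \<open>F'\<close> (\<open>deriv_energy_quotient\<close>).  Hence \<open>E / m\<close> increases and \<open>E / p\<close> decreases
(the latter where \<open>p > 0\<close>).  Since \<open>E / m\<close> tends to \<open>0\<close> at the origin and \<open>E\<close> tends to \<open>1\<close> at infinity,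
one gets \<open>0 < E\<close> and \<open>p < E < m\<close> for all \<open>x > 0\<close> (\<open>coulomb_energy_bounds\<close>).  The theorem is read off from
\<open>E = F'\<^sup>2 + p m F\<^sup>2\<close>: omitting one of the two squares in \<open>E < m\<close> gives the upper bounds for \<open>p > 0\<close>, and
at a zero of \<open>F\<close> or of \<open>F'\<close> only one square is left, so that \<open>p < E\<close> gives the lower bounds; at a zero of
\<open>F'\<close> the positivity of \<open>E\<close> forces \<open>p > 0\<close>.

The behaviour at the origin follows from the power series of \<open>F\<close>
(\<open>coulomb_energy_near_zero\<close>): the leading terms of \<open>F'\<^sup>2\<close> and \<open>- a\<^sup>2 F\<^sup>2 / x\<^sup>2\<close> cancel, and so do the next ones,
so that \<open>E / m\<close> is of order \<open>x powr (2 * a + 1)\<close>.  This is where \<open>l > -3/2\<close> enters.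

The limit \<open>1\<close> at infinity is the statement that the constant \<open>C\<close> normalizes the amplitude of \<open>F\<close> to \<open>1\<close>.
For \<open>a \<ge> 1\<close> the equation has the solution \<open>H = x powr a * exp (- \<i> x) * h\<close>, where
\<open>h\<close> is the Laplace transform of \<open>s powr (a - 1 - \<i> \<eta>) * (s + 2 \<i>) powr (a - 1 + \<i> \<eta>)\<close>.
From the integral, the size of \<open>H\<close> is known at infinity and its singular part is known at the origin
(\<open>jost_at_infinity\<close>, \<open>jost_near_zero\<close>).  The Wronskian of \<open>F\<close> and \<open>H\<close> is constant and can be evaluated at
the origin; the Wronskian of \<open>H\<close> and its conjugate can be evaluated at infinity.  Together they express \<open>F\<close>
through \<open>H\<close> and give its amplitude (\<open>coulomb_series_amplitude\<close>).  Smaller \<open>a\<close> are reached by the ladder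
relations between the solutions for \<open>a\<close> and \<open>a + 1\<close>, which show that their energies differ by a term that
vanishes at infinity (\<open>coulomb_energy_shift\<close>).
\<close>

section \<open>The power series factor of the regular solution\<close>

text \<open>
The recursion that the equation \<open>x \<phi>'' + 2 a \<phi>' + (x - 2 \<eta>) \<phi> = 0\<close> forces on the coefficients of a power series
solution with \<open>\<phi> 0 = 1\<close>.  Starting from it, rather than from the product of the exponential and the
Kummer series, makes it evident that the solution is real.
\<close>

fun coulomb_coeff :: "real \<Rightarrow> real \<Rightarrow> nat \<Rightarrow> real" where
  "coulomb_coeff a \<eta> 0 = 1"
| "coulomb_coeff a \<eta> (Suc 0) = \<eta> / a"
| "coulomb_coeff a \<eta> (Suc (Suc k)) =
     (2 * \<eta> * coulomb_coeff a \<eta> (Suc k) - coulomb_coeff a \<eta> k) /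
       (of_nat (k + 2) * (of_nat (k + 1) + 2 * a))"

definition coulomb_fps :: "real \<Rightarrow> real \<Rightarrow> real fps" where
  "coulomb_fps a \<eta> = Abs_fps (coulomb_coeff a \<eta>)"

definition coulomb_series :: "real \<Rightarrow> real \<Rightarrow> real \<Rightarrow> real" where
  "coulomb_series a \<eta> = eval_fps (coulomb_fps a \<eta>)"

definition coulomb_series' :: "real \<Rightarrow> real \<Rightarrow> real \<Rightarrow> real" where
  "coulomb_series' a \<eta> = eval_fps (fps_deriv (coulomb_fps a \<eta>))"

definition kummer_fps :: "complex \<Rightarrow> complex \<Rightarrow> complex \<Rightarrow> complex fps" where
  "kummer_fps A B w = Abs_fps (\<lambda>k. pochhammer A k / pochhammer B k * (w ^ k / fact k))"

lemma eval_kummer_fps: "eval_fps (kummer_fps A B w) z = kummer_1F1 A B (w * z)"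
  by (simp add: eval_fps_def kummer_fps_def kummer_1F1_def power_mult_distrib mult_ac)

lemma kummer_fps_Suc:
  assumes "\<And>n. B + of_nat n \<noteq> 0"
  shows "of_nat (Suc k) * (B + of_nat k) * fps_nth (kummer_fps A B w) (Suc k) =
           (A + of_nat k) * w * fps_nth (kummer_fps A B w) k"
proof -
  have "pochhammer B k \<noteq> 0" using assms by (auto simp: pochhammer_eq_0_iff) (metis add.right_inverse)
  thus ?thesis using assms[of k]
    by (simp add: kummer_fps_def pochhammer_Suc divide_simps del: of_nat_Suc)
qed

lemma fps_conv_radius_kummer:
  assumes "\<And>n. B + of_nat n \<noteq> 0"
  shows "fps_conv_radius (kummer_fps A B w) = \<infinity>"
proof -
  let ?K = "fps_nth (kummer_fps A B w)"
  have ratio: "?K (Suc k) = (A + of_nat k) * w / (of_nat (Suc k) * (B + of_nat k)) * ?K k" for k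
  proof -
    have "of_nat (Suc k) * (B + of_nat k) \<noteq> 0" using assms[of k] by (simp del: of_nat_Suc)
    moreover have "of_nat (Suc k) * (B + of_nat k) * ?K (Suc k) = (A + of_nat k) * w * ?K k"
      by (rule kummer_fps_Suc[OF assms])
    ultimately show ?thesis
      by (metis nonzero_mult_div_cancel_left times_divide_eq_left)
  qed
  have lim: "(\<lambda>k. norm ((A + of_nat k) * w / (of_nat (Suc k) * (B + of_nat k)))) \<longlonglongrightarrow> 0"
  proof -
    have "filterlim (\<lambda>k. B + of_nat k) at_infinity sequentially"
      by (intro tendsto_add_filterlim_at_infinity[OF tendsto_const] tendsto_of_nat)
    moreover have "filterlim (\<lambda>k. of_nat (Suc k) :: complex) at_infinity sequentially"
      using tendsto_of_nat by (rule filterlim_compose) (rule filterlim_Suc)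
    ultimately have "(\<lambda>k. (1 + (A - B) / (B + of_nat k)) * (w / of_nat (Suc k))) \<longlonglongrightarrow> (1 + 0) * 0"
      by (intro tendsto_intros tendsto_divide_0[OF tendsto_const])
    moreover have "(1 + (A - B) / (B + of_nat k)) * (w / of_nat (Suc k)) =
        (A + of_nat k) * w / (of_nat (Suc k) * (B + of_nat k))" for k
      using assms[of k] by (simp add: field_simps del: of_nat_Suc)
    ultimately show ?thesis by (simp add: tendsto_norm_zero)
  qed
  have "summable (\<lambda>k. ?K k * z ^ k)" for z
  proof -
    have "(\<lambda>k. norm ((A + of_nat k) * w / (of_nat (Suc k) * (B + of_nat k))) * norm z) \<longlonglongrightarrow> 0 * norm z"
      by (intro tendsto_intros lim)
    hence "\<forall>\<^sub>F k in sequentially. norm ((A + of_nat k) * w / (of_nat (Suc k) * (B + of_nat k))) * norm z < 1 / 2"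
      by (rule order_tendstoD) auto
    then obtain N where N: "\<And>k. k \<ge> N \<Longrightarrow>
        norm ((A + of_nat k) * w / (of_nat (Suc k) * (B + of_nat k))) * norm z < 1 / 2"
      by (auto simp: eventually_sequentially)
    show ?thesis
    proof (rule summable_ratio_test[of "1/2" N])
      fix k assume "k \<ge> N"
      have "norm (?K (Suc k) * z ^ Suc k) =
         (norm ((A + of_nat k) * w / (of_nat (Suc k) * (B + of_nat k))) * norm z) * norm (?K k * z ^ k)"
        unfolding ratio by (simp only: norm_mult power_Suc mult_ac)
      also have "\<dots> \<le> 1 / 2 * norm (?K k * z ^ k)"
        using N[OF \<open>k \<ge> N\<close>] by (intro mult_right_mono) auto
      finally show "norm (?K (Suc k) * z ^ Suc k) \<le> 1 / 2 * norm (?K k * z ^ k)" .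
    qed auto
  qed
  thus ?thesis unfolding fps_conv_radius_def by (rule conv_radius_inftyI'')
qed

text \<open>
Kummer's equation, stated for formal power series so that the product with the exponential can be
differentiated algebraically.
\<close>

lemma kummer_fps_ode:
  fixes A B w :: complex
  assumes "\<And>n. B + of_nat n \<noteq> 0"
  defines "K \<equiv> kummer_fps A B w"
  shows "fps_X * fps_deriv (fps_deriv K) + fps_const B * fps_deriv K =
           fps_const w * (fps_X * fps_deriv K) + fps_const (A * w) * K"
proof (rule fps_ext)
  fix k
  show "fps_nth (fps_X * fps_deriv (fps_deriv K) + fps_const B * fps_deriv K) k =
        fps_nth (fps_const w * (fps_X * fps_deriv K) + fps_const (A * w) * K) k"
    using kummer_fps_Suc[OF assms(1), where A=A and w=w and k=k]
    by (cases k) (simp_all add: K_def[symmetric] algebra_simps)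
qed

lemma coulomb_coeff_rec:
  assumes a: "a > -1/2" "a \<noteq> 0"
  shows "real (k + 2) * (real (k + 1) + 2 * a) * coulomb_coeff a \<eta> (Suc (Suc k)) =
     2 * \<eta> * coulomb_coeff a \<eta> (Suc k) - coulomb_coeff a \<eta> k"
proof -
  have "2 * a + real (k + 1) \<noteq> 0" using a by auto
  thus ?thesis by (simp add: add_ac)
qed

lemma double_plus_of_nat_nonzero:
  assumes "a > -1/2" "a \<noteq> 0"
  shows "complex_of_real (2 * a) + of_nat n \<noteq> 0"
proof -
  have "2 * a + real n \<noteq> 0" using assms by (cases n) auto
  thus ?thesis by (metis of_real_add of_real_eq_0_iff of_real_of_nat_eq)
qed

text \<open>
The substitution \<open>\<phi> = exp (- \<i> x) K\<close> turns Kummer's equation into the Coulomb equation for \<open>\<phi>\<close>, and the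
latter determines the coefficients of \<open>\<phi>\<close> recursively from the constant term; for \<open>a > -1/2\<close>, \<open>a \<noteq> 0\<close> no
factor that has to be divided out vanishes.
\<close>

lemma coulomb_fps_conv_kummer:
  fixes a \<eta> :: real
  assumes a: "a > -1/2" "a \<noteq> 0"
  shows "fps_exp (-\<i>) * kummer_fps (Complex a (- \<eta>)) (of_real (2 * a)) (2 * \<i>) =
           Abs_fps (\<lambda>k. of_real (coulomb_coeff a \<eta> k))"
proof -
  let ?A = "Complex a (- \<eta>)" and ?B = "complex_of_real (2 * a)"
  define K where "K = kummer_fps ?A ?B (2 * \<i>)"
  define E where "E = fps_exp (-\<i>)"
  define P where "P = E * K"
  have B: "?B + of_nat n \<noteq> 0" for n
    using a by (rule double_plus_of_nat_nonzero)
  have E': "fps_deriv E = fps_const (-\<i>) * E" by (simp add: E_def)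
  have "fps_X * fps_deriv (fps_deriv P) + fps_const ?B * fps_deriv P + fps_X * P
      = fps_const (of_real (2 * \<eta>)) * P"
  proof -
    have A: "?A = of_real a - \<i> * of_real \<eta>" by (simp add: complex_eq_iff)
    have K': "fps_X * fps_deriv (fps_deriv K) =
       fps_const (2*\<i>) * (fps_X * fps_deriv K) + fps_const (?A * (2*\<i>)) * K - fps_const ?B * fps_deriv K"
      using kummer_fps_ode[OF B, where A = ?A and w = "2*\<i>"] by (simp add: K_def algebra_simps)
    have ii: "fps_const \<i> * fps_const \<i> = - (1 :: complex fps)"
      by (simp add: fps_const_mult fps_const_neg[symmetric] del: fps_const_neg)
    have 1: "fps_deriv P = E * (fps_deriv K - fps_const \<i> * K)"
      unfolding P_def by (simp add: E' fps_const_neg[symmetric] del: fps_const_neg) (simp add: algebra_simps)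
    have 2: "fps_deriv (fps_deriv P) = E * (fps_deriv (fps_deriv K) - 2 * fps_const \<i> * fps_deriv K - K)"
    proof -
      have "fps_deriv (fps_deriv P) = E * (fps_deriv (fps_deriv K) - fps_const \<i> * fps_deriv K) -
              fps_const \<i> * E * (fps_deriv K - fps_const \<i> * K)"
        unfolding 1 by (simp add: E' fps_const_neg[symmetric] del: fps_const_neg)
      thus ?thesis using ii by algebra
    qed
    have AB: "fps_const (?A * (2*\<i>)) = fps_const \<i> * fps_const ?B + fps_const (of_real (2*\<eta>))"
      by (simp add: A algebra_simps)
    have c2: "fps_const (2*\<i>) = 2 * fps_const \<i>"
      by (metis fps_const_mult fps_numeral_fps_const)
    show ?thesis unfolding 2 unfolding 1 using K' unfolding AB c2 P_def by algebra
  qed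
  hence rec: "fps_nth (fps_X * fps_deriv (fps_deriv P) + fps_const ?B * fps_deriv P + fps_X * P) k
      = fps_nth (fps_const (of_real (2 * \<eta>)) * P) k" for k by simp
  have "fps_nth P k = of_real (coulomb_coeff a \<eta> k)" for k
  proof (induction k rule: induct_nat_012)
    case 0
    show ?case by (simp add: P_def E_def K_def kummer_fps_def)
  next
    case 1
    have "2 * of_real a * fps_nth P 1 = 2 * of_real \<eta> * fps_nth P 0"
      using rec[of 0] by simp
    moreover have "fps_nth P 0 = 1" by (simp add: P_def E_def K_def kummer_fps_def)
    ultimately show ?case using a by (simp add: field_simps)
  next
    case (ge2 k)
    define D where "D = real (k + 2) * (real (k + 1) + 2 * a)"
    have D: "D \<noteq> 0" using a by (auto simp: D_def)
    have "complex_of_real D * fps_nth P (Suc (Suc k))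
        = 2 * of_real \<eta> * fps_nth P (Suc k) - fps_nth P k"
      using rec[of "Suc k"] by (simp add: D_def algebra_simps)
    also have "\<dots> = of_real (2 * \<eta> * coulomb_coeff a \<eta> (Suc k) - coulomb_coeff a \<eta> k)"
      using ge2 by simp
    also have "\<dots> = complex_of_real D * of_real (coulomb_coeff a \<eta> (Suc (Suc k)))"
      using coulomb_coeff_rec[OF a, of k \<eta>] unfolding D_def by (metis of_real_mult)
    finally show ?case using D by (simp del: coulomb_coeff.simps)
  qed
  thus ?thesis by (simp add: P_def E_def K_def fps_eq_iff)
qed

lemma fps_conv_radius_coulomb:
  assumes a: "a > -1/2" "a \<noteq> 0"
  shows "fps_conv_radius (coulomb_fps a \<eta>) = \<infinity>"
proof -
  have B: "complex_of_real (2 * a) + of_nat n \<noteq> 0" for n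
    using a by (rule double_plus_of_nat_nonzero)
  define K where "K = kummer_fps (Complex a (- \<eta>)) (of_real (2 * a)) (2 * \<i>)"
  have "fps_conv_radius K = \<infinity>" unfolding K_def by (rule fps_conv_radius_kummer[OF B])
  hence "fps_conv_radius (fps_exp (-\<i>) * K) = \<infinity>"
    using fps_conv_radius_mult[of "fps_exp (-\<i>)" K] by simp
  hence "fps_conv_radius (Abs_fps (\<lambda>k. complex_of_real (coulomb_coeff a \<eta> k))) = \<infinity>"
    unfolding K_def coulomb_fps_conv_kummer[OF a] .
  moreover have "conv_radius (\<lambda>k. complex_of_real (coulomb_coeff a \<eta> k)) = conv_radius (coulomb_coeff a \<eta>)"
    by (subst (1 2) conv_radius_norm[symmetric]) simp
  ultimately show ?thesis by (simp add: fps_conv_radius_def coulomb_fps_def)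
qed

lemma coulomb_phi_raw_eq_series:
  assumes a: "l + 1 > -1/2" "l + 1 \<noteq> 0"
  shows "coulomb_phi_raw l \<eta> x = of_real (coulomb_series (l + 1) \<eta> x)"
proof -
  let ?a = "l + 1"
  let ?K = "kummer_fps (Complex ?a (- \<eta>)) (of_real (2 * ?a)) (2 * \<i>)"
  have B: "complex_of_real (2 * ?a) + of_nat n \<noteq> 0" for n
    using a by (rule double_plus_of_nat_nonzero)
  have "coulomb_phi_raw l \<eta> x = eval_fps (fps_exp (-\<i>)) (of_real x) * eval_fps ?K (of_real x)"
    unfolding coulomb_phi_raw_def eval_kummer_fps eval_fps_exp by (simp add: algebra_simps)
  also have "\<dots> = eval_fps (fps_exp (-\<i>) * ?K) (of_real x)"
    by (rule eval_fps_mult[symmetric]) (simp, unfold fps_conv_radius_kummer[OF B], simp)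
  also have "\<dots> = (\<Sum>k. of_real (coulomb_coeff ?a \<eta> k * x ^ k))"
    unfolding coulomb_fps_conv_kummer[OF a] eval_fps_def by simp
  also have "\<dots> = of_real (\<Sum>k. coulomb_coeff ?a \<eta> k * x ^ k)"
    using summable_fps[of x "coulomb_fps ?a \<eta>"] fps_conv_radius_coulomb[OF a]
    by (intro suminf_of_real[symmetric]) (simp add: coulomb_fps_def)
  finally show ?thesis by (simp add: coulomb_series_def coulomb_fps_def eval_fps_def)
qed

lemma coulomb_series_0 [simp]: "coulomb_series a \<eta> 0 = 1"
  by (simp add: coulomb_series_def eval_fps_at_0 coulomb_fps_def)

context
  fixes a \<eta> :: real
  assumes a: "a > -1/2" "a \<noteq> 0"
begin

lemma fps_conv_radius_coulomb_deriv:
  "fps_conv_radius (fps_deriv (coulomb_fps a \<eta>)) = \<infinity>"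
  "fps_conv_radius (fps_deriv (fps_deriv (coulomb_fps a \<eta>))) = \<infinity>"
  using fps_conv_radius_coulomb[OF a, of \<eta>] fps_conv_radius_deriv[of "coulomb_fps a \<eta>"]
    fps_conv_radius_deriv[of "fps_deriv (coulomb_fps a \<eta>)"] by auto

lemma deriv_coulomb_series:
  "(coulomb_series a \<eta> has_real_derivative coulomb_series' a \<eta> x) (at x)"
  unfolding coulomb_series_def[abs_def] coulomb_series'_def
  by (rule has_field_derivative_eval_fps) (simp add: fps_conv_radius_coulomb[OF a])

lemma isCont_coulomb_series': "isCont (coulomb_series' a \<eta>) x"
  unfolding coulomb_series'_def[abs_def]
  by (rule DERIV_isCont[OF has_field_derivative_eval_fps]) (simp add: fps_conv_radius_coulomb_deriv)

lemma coulomb_fps_ode: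
  "fps_X * fps_deriv (fps_deriv (coulomb_fps a \<eta>)) + fps_const (2 * a) * fps_deriv (coulomb_fps a \<eta>)
     + fps_X * coulomb_fps a \<eta> = fps_const (2 * \<eta>) * coulomb_fps a \<eta>"
proof (rule fps_ext)
  fix k
  show "fps_nth (fps_X * fps_deriv (fps_deriv (coulomb_fps a \<eta>)) +
     fps_const (2 * a) * fps_deriv (coulomb_fps a \<eta>) + fps_X * coulomb_fps a \<eta>) k =
     fps_nth (fps_const (2 * \<eta>) * coulomb_fps a \<eta>) k"
  proof (cases k)
    case 0
    thus ?thesis using a by (simp add: coulomb_fps_def)
  next
    case (Suc j)
    thus ?thesis using coulomb_coeff_rec[OF a, of j] by (simp add: coulomb_fps_def algebra_simps del: coulomb_coeff.simps)
  qed
qed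

lemma deriv_coulomb_series':
  assumes "x \<noteq> 0"
  shows "(coulomb_series' a \<eta> has_real_derivative
     ((2 * \<eta> - x) * coulomb_series a \<eta> x - 2 * a * coulomb_series' a \<eta> x) / x) (at x)"
proof -
  let ?F = "coulomb_fps a \<eta>"
  note r = fps_conv_radius_coulomb[OF a, of \<eta>] fps_conv_radius_coulomb_deriv
  have "eval_fps (fps_X * fps_deriv (fps_deriv ?F) + fps_const (2 * a) * fps_deriv ?F + fps_X * ?F) x
      = x * eval_fps (fps_deriv (fps_deriv ?F)) x + 2 * a * coulomb_series' a \<eta> x + x * coulomb_series a \<eta> x"
  proof -
    have 1: "fps_conv_radius (fps_X * fps_deriv (fps_deriv ?F)) = \<infinity>"
      using fps_conv_radius_mult[of fps_X "fps_deriv (fps_deriv ?F)"] r by simp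
    have 2: "fps_conv_radius (fps_const (2 * a) * fps_deriv ?F) = \<infinity>"
      using fps_conv_radius_mult[of "fps_const (2 * a)" "fps_deriv ?F"] r by simp
    have 3: "fps_conv_radius (fps_X * ?F) = \<infinity>"
      using fps_conv_radius_mult[of fps_X ?F] r by simp
    have 4: "fps_conv_radius (fps_X * fps_deriv (fps_deriv ?F) + fps_const (2 * a) * fps_deriv ?F) = \<infinity>"
      using fps_conv_radius_add[of "fps_X * fps_deriv (fps_deriv ?F)" "fps_const (2 * a) * fps_deriv ?F"] 1 2
      by simp
    show ?thesis
      by (simp add: eval_fps_add eval_fps_mult 1 2 3 4 r coulomb_series_def coulomb_series'_def)
  qed
  moreover have "eval_fps (fps_const (2 * \<eta>) * ?F) x = 2 * \<eta> * coulomb_series a \<eta> x"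
    by (simp add: eval_fps_mult r coulomb_series_def)
  ultimately have "x * eval_fps (fps_deriv (fps_deriv ?F)) x =
      (2 * \<eta> - x) * coulomb_series a \<eta> x - 2 * a * coulomb_series' a \<eta> x"
    unfolding coulomb_fps_ode by (simp add: algebra_simps)
  hence "eval_fps (fps_deriv (fps_deriv ?F)) x =
      ((2 * \<eta> - x) * coulomb_series a \<eta> x - 2 * a * coulomb_series' a \<eta> x) / x"
    using assms by (simp add: field_simps)
  moreover have "(coulomb_series' a \<eta> has_real_derivative eval_fps (fps_deriv (fps_deriv ?F)) x) (at x)"
    unfolding coulomb_series'_def[abs_def]
    by (rule has_field_derivative_eval_fps) (simp add: r)
  ultimately show ?thesis by simp
qed

end

text \<open>
The coefficient form of the ladder relation below.  Both sides satisfy the recursion of the coefficients for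
\<open>a + 1\<close>, so that a two-step induction proves it.
\<close>

lemma coulomb_coeff_shift:
  assumes a: "a > -1/2" "a \<noteq> 0"
  shows "(a\<^sup>2 + \<eta>\<^sup>2) / (a * (2 * a + 1)) * coulomb_coeff (a + 1) \<eta> k =
     \<eta> * coulomb_coeff a \<eta> (Suc k) - a * real (k + 2) * coulomb_coeff a \<eta> (Suc (Suc k))"
proof -
  define c where "c = coulomb_coeff a \<eta>"
  define d where "d = coulomb_coeff (a + 1) \<eta>"
  define \<kappa> where "\<kappa> = (a\<^sup>2 + \<eta>\<^sup>2) / (a * (2 * a + 1))"
  have a1: "a + 1 > -1/2" "a + 1 \<noteq> 0" using a by auto
  have c: "real (k + 2) * (real (k + 1) + 2 * a) * c (Suc (Suc k)) = 2 * \<eta> * c (Suc k) - c k" for k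
    unfolding c_def by (rule coulomb_coeff_rec[OF a])
  have d: "real (k + 2) * (real (k + 3) + 2 * a) * d (Suc (Suc k)) = 2 * \<eta> * d (Suc k) - d k" for k
    using coulomb_coeff_rec[OF a1, of k \<eta>] by (simp add: d_def algebra_simps del: coulomb_coeff.simps)
  have c1: "a * c 1 = \<eta>" using a by (simp add: c_def)
  have c0: "c 0 = 1" "d 0 = 1" by (simp_all add: c_def d_def)
  have base: "\<kappa> = \<eta> * c 1 - a * 2 * c 2"
  proof -
    have ne: "2 * a + 1 \<noteq> 0" using a by auto
    have "2 * (1 + 2 * a) * c 2 = 2 * \<eta> * c 1 - 1" using c[of 0] c0 by (simp add: numeral_2_eq_2)
    hence "a * (2 * a + 1) * (\<eta> * c 1 - a * 2 * c 2) = a\<^sup>2 + \<eta>\<^sup>2"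
      using c1 by algebra
    moreover have "a * (2 * a + 1) \<noteq> 0" using ne a by simp
    ultimately show ?thesis unfolding \<kappa>_def by (metis nonzero_mult_div_cancel_left)
  qed
  have "\<kappa> * d k = \<eta> * c (Suc k) - a * real (k + 2) * c (Suc (Suc k))"
  proof (induction k rule: induct_nat_012)
    case 0
    show ?case using base c0 by (simp add: numeral_2_eq_2)
  next
    case 1
    have "(2 * a + 2) * d 1 = 2 * \<eta>" using a by (simp add: d_def field_simps)
    moreover have "6 * (1 + a) * c 3 = 2 * \<eta> * c 2 - c 1"
      using c[of 1] by (simp add: eval_nat_numeral algebra_simps)
    moreover have "2 * (1 + 2 * a) * c 2 = 2 * \<eta> * c 1 - 1"
      using c[of 0] c0 by (simp add: numeral_2_eq_2)
    ultimately have "(2 * a + 2) * (\<kappa> * d 1) = (2 * a + 2) * (\<eta> * c 2 - a * 3 * c 3)"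
      using base c1 by algebra
    thus ?case using a by (simp add: eval_nat_numeral)
  next
    case (ge2 k)
    define K where "K = real k"
    have "(K + 2) * (K + 3 + 2 * a) * d (Suc (Suc k)) = 2 * \<eta> * d (Suc k) - d k"
      using d[of k] by (simp add: K_def add_ac)
    moreover have "(K + 3) * (K + 2 + 2 * a) * c (Suc (Suc (Suc k))) = 2 * \<eta> * c (Suc (Suc k)) - c (Suc k)"
      using c[of "Suc k"] by (simp add: K_def add_ac)
    moreover have "(K + 4) * (K + 3 + 2 * a) * c (Suc (Suc (Suc (Suc k)))) =
         2 * \<eta> * c (Suc (Suc (Suc k))) - c (Suc (Suc k))"
      using c[of "Suc (Suc k)"] by (simp add: K_def add_ac)
    moreover have "\<kappa> * d k = \<eta> * c (Suc k) - a * (K + 2) * c (Suc (Suc k))"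
      "\<kappa> * d (Suc k) = \<eta> * c (Suc (Suc k)) - a * (K + 3) * c (Suc (Suc (Suc k)))"
      using ge2 by (simp_all add: K_def add_ac)
    ultimately have "(K + 2) * (K + 3 + 2 * a) * (\<kappa> * d (Suc (Suc k))) =
       (K + 2) * (K + 3 + 2 * a) * (\<eta> * c (Suc (Suc (Suc k))) - a * (K + 4) * c (Suc (Suc (Suc (Suc k)))))"
      by algebra
    moreover have "(K + 2) * (K + 3 + 2 * a) \<noteq> 0" using a by (simp add: K_def)
    ultimately have "\<kappa> * d (Suc (Suc k)) = \<eta> * c (Suc (Suc (Suc k))) - a * (K + 4) * c (Suc (Suc (Suc (Suc k))))"
      by (simp only: mult_cancel_left) simp
    thus ?case by (simp add: K_def add_ac)
  qed
  thus ?thesis by (simp add: c_def d_def \<kappa>_def)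
qed

text \<open>
This relation is what makes the recursion from \<open>a + 1\<close> down to \<open>a\<close> possible, and it also exhibits the
cancellation in the energy at the origin: \<open>a \<phi>' - \<eta> \<phi>\<close> vanishes there to first order.
\<close>

lemma coulomb_series_shift:
  assumes a: "a > -1/2" "a \<noteq> 0"
  shows "a * coulomb_series' a \<eta> x = \<eta> * coulomb_series a \<eta> x -
     (a\<^sup>2 + \<eta>\<^sup>2) / (a * (2 * a + 1)) * (x * coulomb_series (a + 1) \<eta> x)"
proof -
  let ?F = "coulomb_fps a \<eta>" and ?G = "coulomb_fps (a + 1) \<eta>"
  define \<kappa> where "\<kappa> = (a\<^sup>2 + \<eta>\<^sup>2) / (a * (2 * a + 1))"
  have a1: "a + 1 > -1/2" "a + 1 \<noteq> 0" using a by auto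
  note r = fps_conv_radius_coulomb[OF a, of \<eta>] fps_conv_radius_coulomb_deriv[OF a]
    fps_conv_radius_coulomb[OF a1, of \<eta>]
  have rX: "fps_conv_radius (fps_X * ?G) = \<infinity>" using fps_conv_radius_mult[of fps_X ?G] r by simp
  have rc: "fps_conv_radius (fps_const \<eta> * ?F) = \<infinity>" "fps_conv_radius (fps_const \<kappa> * (fps_X * ?G)) = \<infinity>"
    using fps_conv_radius_mult[of "fps_const \<eta>" ?F] fps_conv_radius_mult[of "fps_const \<kappa>" "fps_X * ?G"] r rX
    by simp_all
  have "fps_const a * fps_deriv ?F = fps_const \<eta> * ?F - fps_const \<kappa> * (fps_X * ?G)"
  proof (rule fps_ext)
    fix k
    show "fps_nth (fps_const a * fps_deriv ?F) k = fps_nth (fps_const \<eta> * ?F - fps_const \<kappa> * (fps_X * ?G)) k"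
    proof (cases k)
      case 0
      thus ?thesis using a by (simp add: coulomb_fps_def)
    next
      case (Suc j)
      thus ?thesis using coulomb_coeff_shift[OF a, of \<eta> j]
        by (simp add: coulomb_fps_def \<kappa>_def algebra_simps del: coulomb_coeff.simps)
    qed
  qed
  hence "eval_fps (fps_const a * fps_deriv ?F) x = eval_fps (fps_const \<eta> * ?F - fps_const \<kappa> * (fps_X * ?G)) x"
    by simp
  hence "a * coulomb_series' a \<eta> x =
      \<eta> * coulomb_series a \<eta> x - \<kappa> * (x * coulomb_series (a + 1) \<eta> x)"
    by (simp add: eval_fps_diff eval_fps_mult r rX rc coulomb_series_def coulomb_series'_def)
  thus ?thesis by (simp add: \<kappa>_def)
qed

section \<open>Laplace integrals\<close>

lemma shifted_powr_le_exp:
  assumes "N \<ge> 0" "k > 0"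
  obtains C where "\<And>s :: real. s \<ge> 0 \<Longrightarrow> (s + 2) powr N \<le> C * exp (k * s)"
proof (cases "N = 0")
  case True
  thus ?thesis using assms by (intro that[of 1]) auto
next
  case False
  define \<epsilon> where "\<epsilon> = k / N"
  have \<epsilon>: "\<epsilon> > 0" using assms False by (simp add: \<epsilon>_def)
  show ?thesis
  proof (rule that[of "(2 + 1 / \<epsilon>) powr N"])
    fix s :: real assume s: "s \<ge> 0"
    have "s + 2 \<le> (2 + 1 / \<epsilon>) * (1 + \<epsilon> * s)"
      using s \<epsilon> by (simp add: field_simps)
    also have "\<dots> \<le> (2 + 1 / \<epsilon>) * exp (\<epsilon> * s)"
      using \<epsilon> exp_ge_add_one_self[of "\<epsilon> * s"] by (intro mult_left_mono) auto
    finally have "(s + 2) powr N \<le> ((2 + 1 / \<epsilon>) * exp (\<epsilon> * s)) powr N"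
      using s assms by (intro powr_mono2) auto
    also have "\<dots> = (2 + 1 / \<epsilon>) powr N * exp (k * s)"
    proof -
      have "exp (\<epsilon> * s) powr N = exp (k * s)" using False by (simp add: exp_powr_real \<epsilon>_def)
      thus ?thesis using \<epsilon> by (subst powr_mult) auto
    qed
    finally show "(s + 2) powr N \<le> (2 + 1 / \<epsilon>) powr N * exp (k * s)" .
  qed
qed

lemma set_integrable_exp_minus:
  assumes "k > (0::real)"
  shows "set_integrable lborel {0<..} (\<lambda>s. exp (- (k * s)))"
proof -
  have "(\<lambda>t. complex_of_real t powr (1 - 1) / of_real (exp (k * t))) absolutely_integrable_on {0<..}"
    using assms by (intro absolutely_integrable_Gamma_integral) auto
  hence "(\<lambda>t. norm (complex_of_real t powr (1 - 1) / of_real (exp (k * t)))) absolutely_integrable_on {0<..}"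
    by (rule absolutely_integrable_norm[unfolded o_def])
  also have "?this \<longleftrightarrow> set_integrable lebesgue {0<..} (\<lambda>s. exp (- (k * s)))"
    by (intro set_integrable_cong) (auto simp: norm_divide exp_minus field_simps)
  finally have "integrable (completion lborel) (\<lambda>s. indicat_real {0<..} s *\<^sub>R exp (- (k * s)))"
    by (simp add: set_integrable_def)
  thus ?thesis unfolding set_integrable_def by (subst (asm) integrable_completion) auto
qed

text \<open>
The shift by \<open>2\<close> keeps the base above \<open>1\<close>, so that products of powers of \<open>u\<close> and of \<open>\<bar>u + 2 \<i>\<bar>\<close> can be
dominated by a single power.
\<close>

lemma set_integrable_exp_shifted_powr:
  assumes "N \<ge> 0" "k > (0::real)"
  shows "set_integrable lborel {0<..} (\<lambda>s. exp (- (k * s)) * (s + 2) powr N)"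
proof -
  obtain C where C: "\<And>s. s \<ge> 0 \<Longrightarrow> (s + 2) powr N \<le> C * exp (k / 2 * s)"
    using shifted_powr_le_exp[of N "k / 2"] assms by auto
  have "set_integrable lborel {0<..} (\<lambda>s. C * exp (- (k / 2 * s)))"
    using set_integrable_exp_minus[of "k / 2"] assms by simp
  thus ?thesis
  proof (rule set_integrable_bound)
    show "set_borel_measurable lborel {0<..} (\<lambda>s. exp (- (k * s)) * (s + 2) powr N)"
      unfolding set_borel_measurable_def by measurable
    have "exp (- (k * s)) * (s + 2) powr N \<le> \<bar>C\<bar> * exp (- (k * s / 2))" if "s > 0" for s
    proof -
      have "exp (- (k * s)) * (s + 2) powr N \<le> exp (- (k * s)) * (C * exp (k / 2 * s))"
        using C that by (intro mult_left_mono) auto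
      also have "\<dots> = C * exp (- (k * s / 2))" by (simp flip: exp_add add: field_simps)
      also have "\<dots> \<le> \<bar>C\<bar> * exp (- (k * s / 2))" by (intro mult_right_mono) auto
      finally show ?thesis .
    qed
    thus "AE s in lborel. s \<in> {0<..} \<longrightarrow> norm (exp (- (k * s)) * (s + 2) powr N) \<le> norm (C * exp (- (k / 2 * s)))"
      by (auto simp: abs_mult)
  qed
qed

definition laplace :: "(real \<Rightarrow> complex) \<Rightarrow> real \<Rightarrow> complex" where
  "laplace g x = (LINT s:{0<..}|lborel. exp (- (x * s)) *\<^sub>R g s)"

text \<open>
Only absolute integrability for every positive argument is asked for, because this is stable under
multiplication by the variable, that is, under differentiation of the transform.
\<close>

definition laplace_admissible :: "(real \<Rightarrow> complex) \<Rightarrow> bool" where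
  "laplace_admissible g \<longleftrightarrow> g \<in> borel_measurable borel \<and>
     (\<forall>x>0. set_integrable lborel {0<..} (\<lambda>s. exp (- (x * s)) *\<^sub>R g s))"

lemma laplace_admissible_mult:
  assumes "laplace_admissible g"
  shows "laplace_admissible (\<lambda>s. s *\<^sub>R g s)"
  unfolding laplace_admissible_def
proof (intro conjI allI impI)
  have [measurable]: "g \<in> borel_measurable borel" using assms by (simp add: laplace_admissible_def)
  show "(\<lambda>s. s *\<^sub>R g s) \<in> borel_measurable borel" by measurable
  fix x :: real assume x: "x > 0"
  have "set_integrable lborel {0<..} (\<lambda>s. (2 / x) *\<^sub>R (exp (- (x / 2 * s)) *\<^sub>R g s))"
  proof (intro set_integrable_scaleR_right)
    show "set_integrable lborel {0<..} (\<lambda>s. exp (- (x / 2 * s)) *\<^sub>R g s)"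
      using assms x unfolding laplace_admissible_def by (meson half_gt_zero)
  qed
  thus "set_integrable lborel {0<..} (\<lambda>s. exp (- (x * s)) *\<^sub>R s *\<^sub>R g s)"
  proof (rule set_integrable_bound)
    show "set_borel_measurable lborel {0<..} (\<lambda>s. exp (- (x * s)) *\<^sub>R s *\<^sub>R g s)"
      unfolding set_borel_measurable_def by measurable
    have "exp (- (x * s)) * s \<le> 2 / x * exp (- (x / 2 * s))" if "s > 0" for s
    proof -
      have "x / 2 * s \<le> exp (x / 2 * s)" using exp_ge_add_one_self[of "x / 2 * s"] by linarith
      hence "exp (- (x * s)) * (2 / x * (x / 2 * s)) \<le> exp (- (x * s)) * (2 / x * exp (x / 2 * s))"
        using x by (intro mult_left_mono) auto
      also have "\<dots> = 2 / x * exp (- (x / 2 * s))" by (simp flip: exp_add add: field_simps)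
      finally show ?thesis using x by simp
    qed
    hence "exp (- (x * s)) * s * cmod (g s) \<le> 2 / x * exp (- (x / 2 * s)) * cmod (g s)" if "s > 0" for s
      using that by (intro mult_right_mono) auto
    thus "AE s in lborel. s \<in> {0<..} \<longrightarrow> norm (exp (- (x * s)) *\<^sub>R s *\<^sub>R g s)
           \<le> norm ((2 / x) *\<^sub>R (exp (- (x / 2 * s)) *\<^sub>R g s))"
      using x by (auto simp: mult.assoc)
  qed
qed

lemma abs_exp_minus_diff_le:
  fixes u v m :: real
  assumes "m \<le> u" "m \<le> v"
  shows "\<bar>exp (- u) - exp (- v)\<bar> \<le> \<bar>u - v\<bar> * exp (- m)"
proof -
  have *: "exp (- u) - exp (- v) \<le> \<bar>u - v\<bar> * exp (- m) " if "u \<le> v" "m \<le> u" for u v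
  proof -
    have "1 - (v - u) \<le> exp (- (v - u))" using exp_ge_add_one_self[of "- (v - u)"] by linarith
    hence "exp (- u) * (1 - (v - u)) \<le> exp (- u) * exp (- (v - u))" by (intro mult_left_mono) auto
    also have "\<dots> = exp (- v)" by (simp flip: exp_add)
    finally have "exp (- u) - exp (- v) \<le> (v - u) * exp (- u)" by (simp add: algebra_simps)
    also have "\<dots> \<le> (v - u) * exp (- m)" using that by (intro mult_left_mono) auto
    finally show ?thesis using that by simp
  qed
  show ?thesis
    using *[of u v] *[of v u] assms by (cases "u \<le> v") (auto simp: abs_if)
qed

lemma has_vector_derivative_quotientI:
  fixes f :: "real \<Rightarrow> 'a :: real_normed_vector"
  assumes "((\<lambda>y. (f y - f x) /\<^sub>R (y - x)) \<longlongrightarrow> D) (at x)"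
  shows "(f has_vector_derivative D) (at x)"
proof -
  have "((\<lambda>y. norm ((f y - f x) /\<^sub>R (y - x) - D)) \<longlongrightarrow> 0) (at x)"
    using tendsto_norm_zero[OF iffD1[OF Lim_null assms]] .
  also have "?this \<longleftrightarrow> ((\<lambda>y. norm (f y - f x - (y - x) *\<^sub>R D) / norm (y - x)) \<longlongrightarrow> 0) (at x)"
  proof (intro filterlim_cong refl, unfold eventually_at_filter, intro always_eventually allI impI)
    fix y assume y: "y \<noteq> x"
    have "f y - f x - (y - x) *\<^sub>R D = (y - x) *\<^sub>R ((f y - f x) /\<^sub>R (y - x) - D)"
      using y by (simp add: scaleR_diff_right)
    thus "norm ((f y - f x) /\<^sub>R (y - x) - D) = norm (f y - f x - (y - x) *\<^sub>R D) / norm (y - x)"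
      using y by simp
  qed
  finally show ?thesis
    unfolding has_vector_derivative_def has_derivative_iff_norm
    using bounded_linear_scaleR_left by blast
qed

text \<open>
Dominated convergence for the difference quotients: once the other argument exceeds \<open>x / 2\<close>, they are
bounded by the integrable function \<open>s exp (- x s / 2) \<bar>g s\<bar>\<close>.
\<close>

lemma laplace_has_vector_derivative:
  assumes g: "laplace_admissible g" and x: "x > 0"
  shows "(laplace g has_vector_derivative - laplace (\<lambda>s. s *\<^sub>R g s) x) (at x)"
proof -
  have [measurable]: "g \<in> borel_measurable borel" using g by (simp add: laplace_admissible_def)
  have int: "set_integrable lborel {0<..} (\<lambda>s. exp (- (y * s)) *\<^sub>R g s)" if "y > 0" for y
    using g that by (simp add: laplace_admissible_def)
  have int': "set_integrable lborel {0<..} (\<lambda>s. exp (- (y * s)) *\<^sub>R s *\<^sub>R g s)" if "y > 0" for y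
    using laplace_admissible_mult[OF g] that by (simp add: laplace_admissible_def)
  let ?q = "\<lambda>y s. ((exp (- (y * s)) - exp (- (x * s))) / (y - x)) *\<^sub>R g s"
  have "((\<lambda>y. (laplace g y - laplace g x) /\<^sub>R (y - x)) \<longlongrightarrow> - laplace (\<lambda>s. s *\<^sub>R g s) x) (at x)"
    unfolding tendsto_at_iff_sequentially o_def
  proof (intro allI impI)
    fix y :: "nat \<Rightarrow> real" assume y: "\<forall>i. y i \<in> UNIV - {x}" "y \<longlonglongrightarrow> x"
    from y(2) have "\<forall>\<^sub>F i in sequentially. y i > x / 2"
      by (rule order_tendstoD) (use x in simp)
    then obtain n where n: "\<And>i. i \<ge> n \<Longrightarrow> y i > x / 2" by (auto simp: eventually_sequentially)
    define z where "z i = y (i + n)" for i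
    have z: "z i > x / 2" "z i \<noteq> x" for i using n y by (auto simp: z_def)
    have zlim: "z \<longlonglongrightarrow> x" unfolding z_def using y(2) by (rule LIMSEQ_ignore_initial_segment)
    have "(\<lambda>i. LINT s:{0<..}|lborel. ?q (z i) s) \<longlonglongrightarrow> (LINT s:{0<..}|lborel. - (exp (- (x * s)) *\<^sub>R s *\<^sub>R g s))"
      unfolding set_lebesgue_integral_def
    proof (rule integral_dominated_convergence)
      show "integrable lborel (\<lambda>s. norm (indicat_real {0<..} s *\<^sub>R (exp (- (x / 2 * s)) *\<^sub>R s *\<^sub>R g s)))"
        using int'[of "x / 2"] x unfolding set_integrable_def by (intro integrable_norm) simp
      show "(\<lambda>s. indicat_real {0<..} s *\<^sub>R - (exp (- (x * s)) *\<^sub>R s *\<^sub>R g s)) \<in> borel_measurable lborel"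
        by measurable
      show "(\<lambda>s. indicat_real {0<..} s *\<^sub>R ?q (z i) s) \<in> borel_measurable lborel" for i
        by measurable
      show "AE s in lborel. norm (indicat_real {0<..} s *\<^sub>R ?q (z i) s)
              \<le> norm (indicat_real {0<..} s *\<^sub>R (exp (- (x / 2 * s)) *\<^sub>R s *\<^sub>R g s))" for i
      proof (intro AE_I2)
        fix s :: real
        have "\<bar>(exp (- (z i * s)) - exp (- (x * s))) / (z i - x)\<bar> \<le> exp (- (x / 2 * s)) * s" if "s > 0"
        proof -
          have "\<bar>exp (- (z i * s)) - exp (- (x * s))\<bar> \<le> \<bar>z i * s - x * s\<bar> * exp (- (x / 2 * s))"
            using z[of i] x that by (intro abs_exp_minus_diff_le mult_right_mono) auto
          also have "\<dots> = \<bar>z i - x\<bar> * (exp (- (x / 2 * s)) * s)"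
            using that by (simp add: abs_mult flip: left_diff_distrib)
          finally show ?thesis using z(2)[of i] by (simp add: divide_simps mult_ac)
        qed
        hence "norm (?q (z i) s) \<le> norm (exp (- (x / 2 * s)) *\<^sub>R s *\<^sub>R g s)" if "s > 0"
          using that mult_right_mono[OF _ norm_ge_zero[of "g s"],
             of "\<bar>(exp (- (z i * s)) - exp (- (x * s))) / (z i - x)\<bar>" "exp (- (x / 2 * s)) * s"]
          by simp
        thus "norm (indicat_real {0<..} s *\<^sub>R ?q (z i) s)
              \<le> norm (indicat_real {0<..} s *\<^sub>R (exp (- (x / 2 * s)) *\<^sub>R s *\<^sub>R g s))"
          by (auto simp: indicator_def)
      qed
      show "AE s in lborel. (\<lambda>i. indicat_real {0<..} s *\<^sub>R ?q (z i) s) \<longlonglongrightarrow>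
              indicat_real {0<..} s *\<^sub>R - (exp (- (x * s)) *\<^sub>R s *\<^sub>R g s)"
      proof (intro AE_I2)
        fix s :: real
        have "((\<lambda>y. exp (- (y * s))) has_real_derivative - (s * exp (- (x * s)))) (at x)"
          by (auto intro!: derivative_eq_intros)
        hence "((\<lambda>y. (exp (- (y * s)) - exp (- (x * s))) / (y - x)) \<longlongrightarrow> - (s * exp (- (x * s)))) (at x)"
          by (simp add: has_field_derivative_iff)
        hence "(\<lambda>i. (exp (- (z i * s)) - exp (- (x * s))) / (z i - x)) \<longlonglongrightarrow> - (s * exp (- (x * s)))"
          using z zlim by (auto simp: tendsto_at_iff_sequentially o_def)
        hence "(\<lambda>i. indicat_real {0<..} s *\<^sub>R ?q (z i) s) \<longlonglongrightarrow>
           indicat_real {0<..} s *\<^sub>R (- (s * exp (- (x * s)))) *\<^sub>R g s"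
          by (intro tendsto_intros)
        thus "(\<lambda>i. indicat_real {0<..} s *\<^sub>R ?q (z i) s) \<longlonglongrightarrow>
              indicat_real {0<..} s *\<^sub>R - (exp (- (x * s)) *\<^sub>R s *\<^sub>R g s)"
          by (simp add: mult_ac)
      qed
    qed
    moreover have "(LINT s:{0<..}|lborel. ?q (z i) s) = (laplace g (z i) - laplace g x) /\<^sub>R (z i - x)" for i
    proof -
      have "z i > 0" using z[of i] x by simp
      have "(LINT s:{0<..}|lborel. ?q (z i) s) =
          (LINT s:{0<..}|lborel. inverse (z i - x) *\<^sub>R (exp (- (z i * s)) *\<^sub>R g s - exp (- (x * s)) *\<^sub>R g s))"
        by (simp add: divide_inverse algebra_simps)
      also have "\<dots> = (laplace g (z i) - laplace g x) /\<^sub>R (z i - x)"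
        unfolding laplace_def using int[OF \<open>z i > 0\<close>] int[OF x]
        by (subst set_integral_scaleR_right, subst set_integral_diff) auto
      finally show ?thesis .
    qed
    moreover have "(LINT s:{0<..}|lborel. - (exp (- (x * s)) *\<^sub>R s *\<^sub>R g s)) = - laplace (\<lambda>s. s *\<^sub>R g s) x"
      unfolding laplace_def set_lebesgue_integral_def by simp
    ultimately have "(\<lambda>i. (laplace g (z i) - laplace g x) /\<^sub>R (z i - x)) \<longlonglongrightarrow> - laplace (\<lambda>s. s *\<^sub>R g s) x"
      by simp
    thus "(\<lambda>i. (laplace g (y i) - laplace g x) /\<^sub>R (y i - x)) \<longlonglongrightarrow> - laplace (\<lambda>s. s *\<^sub>R g s) x"
      unfolding z_def by (rule LIMSEQ_offset)
  qed
  thus ?thesis by (rule has_vector_derivative_quotientI)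
qed

lemma Gamma_laplace:
  assumes "Re z > 0"
  shows "laplace (\<lambda>u. of_real u powr (z - 1)) 1 = Gamma z"
proof -
  have "set_integrable lborel {0<..} (\<lambda>u. exp (- (1 * u)) *\<^sub>R of_real u powr (z - 1))"
  proof -
    have "set_integrable lebesgue {0<..} (\<lambda>u. exp (- (1 * u)) *\<^sub>R of_real u powr (z - 1))"
      using absolutely_integrable_Gamma_integral'[OF assms]
      by (simp add: scaleR_conv_of_real exp_minus divide_inverse mult.commute exp_of_real)
    thus ?thesis unfolding set_integrable_def powr_def by (subst (asm) integrable_completion) auto
  qed
  hence "laplace (\<lambda>u. of_real u powr (z - 1)) 1 = integral {0<..} (\<lambda>u. exp (- (1 * u)) *\<^sub>R complex_of_real u powr (z - 1))"
    unfolding laplace_def by (rule set_borel_integral_eq_integral)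
  also have "\<dots> = Gamma z"
    using Gamma_integral_complex'[OF assms]
    by (intro integral_unique) (simp add: scaleR_conv_of_real exp_minus divide_inverse mult.commute exp_of_real)
  finally show ?thesis .
qed

section \<open>An oscillating solution as a Laplace integral\<close>

lemma of_real_inverse_powr:
  assumes "x > 0"
  shows "of_real (1 / x) powr (z - 1) = complex_of_real x powr (1 - z)"
proof -
  have "Ln (of_real (1 / x)) = - complex_of_real (ln x)"
    using assms by (subst Ln_of_real) (auto simp: ln_div)
  thus ?thesis using assms by (simp add: powr_def Ln_of_real algebra_simps)
qed

context
  fixes a \<eta> :: real
begin

text \<open>
The parameters \<open>c\<close> and \<open>d\<close> allow one to treat both ends of the half line at once.  The Laplace transform of
the kernel at \<open>c = d = 1\<close> is the function of interest; substituting \<open>s = u / x\<close> in it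
leads, up to powers of \<open>x\<close>, to the kernel at \<open>(1 / x, 1)\<close> or, equivalently, at \<open>(1, x)\<close>.  So
the behaviour at infinity and at the origin is governed by continuity at \<open>(0, 1)\<close> and at \<open>(1, 0)\<close>.
\<close>

definition jost_kernel :: "real \<Rightarrow> real \<Rightarrow> real \<Rightarrow> complex" where
  "jost_kernel c d u = of_real u powr (Complex a (- \<eta>) - 1) *
     (of_real (c * u) + 2 * \<i> * of_real d) powr (Complex a \<eta> - 1)"

definition jost_scaled :: "nat \<Rightarrow> real \<Rightarrow> real \<Rightarrow> complex" where
  "jost_scaled j c d = laplace (\<lambda>u. u ^ j *\<^sub>R jost_kernel c d u) 1"

definition jost :: "nat \<Rightarrow> real \<Rightarrow> complex" where
  "jost j x = laplace (\<lambda>s. s ^ j *\<^sub>R jost_kernel 1 1 s) x"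

lemma jost_kernel_measurable [measurable]: "jost_kernel c d \<in> borel_measurable borel"
  unfolding jost_kernel_def powr_def by measurable

text \<open>
Both equations come from the substitution \<open>s = u / x\<close>; positive real factors may be pulled out of
complex powers.
\<close>

lemma jost_eq_scaled:
  assumes x: "x > 0"
  shows "jost j x = of_real x powr (- Complex a (- \<eta>)) * of_real x powi (- int j) * jost_scaled j (1 / x) 1"
    and "jost j x = of_real x powr (1 - of_real (2 * a)) * of_real x powi (- int j) * jost_scaled j 1 x"
proof -
  let ?B = "Complex a (- \<eta>)" and ?A = "Complex a \<eta>"
  have K: "jost_kernel 1 1 (u / x) = of_real x powr (1 - ?B) * jost_kernel (1 / x) 1 u"
    "jost_kernel (1 / x) 1 u = of_real x powr (1 - ?A) * jost_kernel 1 x u" if u: "u > 0" for u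
  proof -
    have "of_real (u / x) powr (?B - 1) = (of_real (1 / x) * of_real u) powr (?B - 1)" by simp
    also have "\<dots> = of_real (1 / x) powr (?B - 1) * of_real u powr (?B - 1)"
      using x u by (intro powr_times_real) auto
    also have "of_real (1 / x) powr (?B - 1) = complex_of_real x powr (1 - ?B)"
      by (rule of_real_inverse_powr[OF x])
    finally show "jost_kernel 1 1 (u / x) = of_real x powr (1 - ?B) * jost_kernel (1 / x) 1 u"
      by (simp add: jost_kernel_def)
    have "of_real (1 / x * u) + 2 * \<i> * of_real 1 = of_real (1 / x) * (of_real (1 * u) + 2 * \<i> * of_real x)"
      using x by (simp add: field_simps)
    hence "(of_real (1 / x * u) + 2 * \<i> * of_real 1) powr (?A - 1) =
       of_real (1 / x) powr (?A - 1) * (of_real (1 * u) + 2 * \<i> * of_real x) powr (?A - 1)"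
      using x by (simp only:) (intro powr_times_real_left, auto)
    also have "of_real (1 / x) powr (?A - 1) = complex_of_real x powr (1 - ?A)"
      by (rule of_real_inverse_powr[OF x])
    finally show "jost_kernel (1 / x) 1 u = of_real x powr (1 - ?A) * jost_kernel 1 x u"
      by (simp add: jost_kernel_def)
  qed
  have "jost j x = (1 / x) *\<^sub>R (\<integral>u. indicat_real {0<..} (0 + 1 / x * u) *\<^sub>R
     (exp (- (x * (0 + 1 / x * u))) *\<^sub>R (0 + 1 / x * u) ^ j *\<^sub>R jost_kernel 1 1 (0 + 1 / x * u)) \<partial>lborel)"
    unfolding jost_def laplace_def set_lebesgue_integral_def
    using x by (subst lborel_integral_real_affine[where c = "1 / x" and t = 0]) auto
  also have "(\<integral>u. indicat_real {0<..} (0 + 1 / x * u) *\<^sub>R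
     (exp (- (x * (0 + 1 / x * u))) *\<^sub>R (0 + 1 / x * u) ^ j *\<^sub>R jost_kernel 1 1 (0 + 1 / x * u)) \<partial>lborel)
     = (LINT u:{0<..}|lborel. (of_real x powi (- int j) * of_real x powr (1 - ?B)) *
          (exp (- (1 * u)) *\<^sub>R u ^ j *\<^sub>R jost_kernel (1 / x) 1 u))"
    unfolding set_lebesgue_integral_def
  proof (intro Bochner_Integration.integral_cong refl)
    fix u :: real
    have "indicat_real {0<..} (0 + 1 / x * u) = indicat_real {0<..} u"
      using x by (simp add: indicator_def zero_less_divide_iff)
    thus "indicat_real {0<..} (0 + 1 / x * u) *\<^sub>R
     (exp (- (x * (0 + 1 / x * u))) *\<^sub>R (0 + 1 / x * u) ^ j *\<^sub>R jost_kernel 1 1 (0 + 1 / x * u)) =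
      indicat_real {0<..} u *\<^sub>R ((of_real x powi (- int j) * of_real x powr (1 - ?B)) *
          (exp (- (1 * u)) *\<^sub>R u ^ j *\<^sub>R jost_kernel (1 / x) 1 u))"
      using x K(1)[of u]
      by (cases "u > 0") (simp_all add: power_divide power_int_minus scaleR_conv_of_real field_simps)
  qed
  also have "\<dots> = of_real x powi (- int j) * of_real x powr (1 - ?B) * jost_scaled j (1 / x) 1"
    unfolding jost_scaled_def laplace_def by (rule set_integral_mult_right)
  also have "(1 / x) *\<^sub>R (of_real x powi (- int j) * of_real x powr (1 - ?B) * jost_scaled j (1 / x) 1) =
     (of_real x powr (-1) * of_real x powr (1 - ?B)) * of_real x powi (- int j) * jost_scaled j (1 / x) 1"
    using x by (simp add: scaleR_conv_of_real powr_minus powr_to_1 divide_inverse)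
  also have "complex_of_real x powr (-1) * of_real x powr (1 - ?B) = of_real x powr (- ?B)"
    unfolding powr_add[symmetric] by simp
  finally show 1: "jost j x = of_real x powr (- ?B) * of_real x powi (- int j) * jost_scaled j (1 / x) 1" .
  have "jost_scaled j (1 / x) 1 = (LINT u:{0<..}|lborel. of_real x powr (1 - ?A) *
     (exp (- (1 * u)) *\<^sub>R u ^ j *\<^sub>R jost_kernel 1 x u))"
    unfolding jost_scaled_def laplace_def
    using K(2) by (intro set_lebesgue_integral_cong) auto
  also have "\<dots> = of_real x powr (1 - ?A) * jost_scaled j 1 x"
    unfolding jost_scaled_def laplace_def by (rule set_integral_mult_right)
  finally have "jost j x = (of_real x powr (- ?B) * of_real x powr (1 - ?A)) * of_real x powi (- int j) * jost_scaled j 1 x"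
    by (simp add: 1)
  also have "of_real x powr (- ?B) * of_real x powr (1 - ?A) = complex_of_real x powr (1 - of_real (2 * a))"
    unfolding powr_add[symmetric] by (rule arg_cong2[of _ _ _ _ "(powr)"]) (simp_all add: complex_eq_iff)
  finally show "jost j x = of_real x powr (1 - of_real (2 * a)) * of_real x powi (- int j) * jost_scaled j 1 x" .
qed

context
  assumes a: "a \<ge> 1"
begin

text \<open>
Besides the real power of the modulus, a complex power has a factor depending on the argument of the base,
which is at most \<open>pi\<close> in absolute value.
\<close>

lemma norm_shifted_powr_le:
  assumes "u > 0" "0 \<le> c" "c \<le> 1" "0 \<le> d" "d \<le> 1"
  shows "cmod ((of_real (c * u) + 2 * \<i> * of_real d) powr (Complex a \<eta> - 1)) \<le>
     exp (pi * \<bar>\<eta>\<bar>) * (u + 2) powr (a - 1)"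
proof -
  let ?z = "of_real (c * u) + 2 * \<i> * of_real d :: complex"
  have "cmod ?z \<le> cmod (of_real (c * u)) + cmod (2 * \<i> * of_real d)" by (rule norm_triangle_ineq)
  also have "\<dots> = c * u + 2 * d" using assms by (simp add: norm_mult)
  also have "\<dots> \<le> u + 2"
    using assms mult_right_mono[of c 1 u] by linarith
  finally have z: "cmod ?z \<le> u + 2" .
  have "- \<eta> * Arg ?z \<le> \<bar>\<eta>\<bar> * \<bar>Arg ?z\<bar>" by (metis abs_ge_self abs_minus_cancel abs_mult)
  also have "\<dots> \<le> \<bar>\<eta>\<bar> * pi" using Arg_le_pi[of ?z] mpi_less_Arg[of ?z] by (intro mult_left_mono) auto
  finally have e: "exp (- \<eta> * Arg ?z) \<le> exp (pi * \<bar>\<eta>\<bar>)" by (simp add: mult.commute)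
  have "cmod (?z powr (Complex a \<eta> - 1)) = cmod ?z powr (a - 1) * exp (- \<eta> * Arg ?z)"
    by (simp only: norm_powr_complex) simp
  also have "\<dots> \<le> (u + 2) powr (a - 1) * exp (pi * \<bar>\<eta>\<bar>)"
    using z e a assms by (intro mult_mono powr_mono2) auto
  finally show ?thesis by (simp add: mult.commute)
qed

lemma norm_jost_kernel_le:
  assumes "u > 0" "0 \<le> c" "c \<le> 1" "0 \<le> d" "d \<le> 1"
  shows "cmod (jost_kernel c d u) \<le> exp (pi * \<bar>\<eta>\<bar>) * (u + 2) powr (2 * a - 2)"
proof -
  have "cmod (of_real u powr (Complex a (- \<eta>) - 1)) = u powr (a - 1)"
    using assms by (subst norm_powr_real_powr) auto
  also have "\<dots> \<le> (u + 2) powr (a - 1)" using assms a by (intro powr_mono2) auto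
  finally have "cmod (jost_kernel c d u) \<le> (u + 2) powr (a - 1) * (exp (pi * \<bar>\<eta>\<bar>) * (u + 2) powr (a - 1))"
    unfolding jost_kernel_def norm_mult
    using norm_shifted_powr_le[OF assms] by (intro mult_mono) auto
  also have "\<dots> = exp (pi * \<bar>\<eta>\<bar>) * (u + 2) powr (2 * a - 2)"
    by (simp add: mult_ac flip: powr_add)
  finally show ?thesis .
qed

lemma jost_kernel_admissible: "laplace_admissible (jost_kernel 1 1)"
  unfolding laplace_admissible_def
proof (intro conjI allI impI jost_kernel_measurable)
  fix x :: real assume x: "x > 0"
  have "set_integrable lborel {0<..} (\<lambda>s. exp (pi * \<bar>\<eta>\<bar>) * (exp (- (x * s)) * (s + 2) powr (2 * a - 2)))"
    using a x by (intro set_integrable_mult_right set_integrable_exp_shifted_powr) auto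
  thus "set_integrable lborel {0<..} (\<lambda>s. exp (- (x * s)) *\<^sub>R jost_kernel 1 1 s)"
  proof (rule set_integrable_bound)
    show "set_borel_measurable lborel {0<..} (\<lambda>s. exp (- (x * s)) *\<^sub>R jost_kernel 1 1 s)"
      unfolding set_borel_measurable_def by measurable
    show "AE s in lborel. s \<in> {0<..} \<longrightarrow> norm (exp (- (x * s)) *\<^sub>R jost_kernel 1 1 s) \<le>
            norm (exp (pi * \<bar>\<eta>\<bar>) * (exp (- (x * s)) * (s + 2) powr (2 * a - 2)))"
      using norm_jost_kernel_le[of _ 1 1] by (auto simp: mult.left_commute)
  qed
qed

text \<open>
Dominated convergence.  At \<open>(0, 0)\<close> the base of the second power degenerates to \<open>0\<close>; elsewhere in the
square it stays off the nonpositive real axis for every \<open>u > 0\<close>, so that its power is continuous there.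
\<close>

lemma continuous_on_jost_scaled:
  assumes j: "j \<le> 1"
  shows "continuous_on ({0..1} \<times> {0..1} - {(0, 0)}) (\<lambda>(c, d). jost_scaled j c d)"
  unfolding continuous_on_sequentially
proof (intro allI ballI impI)
  fix X :: "nat \<Rightarrow> real \<times> real" and l
  assume l: "l \<in> {0..1} \<times> {0..1} - {(0, 0)}"
    and X: "(\<forall>n. X n \<in> {0..1} \<times> {0..1} - {(0, 0)}) \<and> X \<longlonglongrightarrow> l"
  define p q where "p n = fst (X n)" and "q n = snd (X n)" for n
  define c0 d0 where "c0 = fst l" and "d0 = snd l"
  have nz: "c0 > 0 \<or> (c0 = 0 \<and> d0 > 0)" using l by (cases l) (auto simp: c0_def d0_def)
  have pq: "0 \<le> p n" "p n \<le> 1" "0 \<le> q n" "q n \<le> 1" for n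
  proof -
    have "X n \<in> {0..1} \<times> {0..1}" using X by blast
    thus "0 \<le> p n" "p n \<le> 1" "0 \<le> q n" "q n \<le> 1" by (cases "X n"; auto simp: p_def q_def)+
  qed
  have lims: "p \<longlonglongrightarrow> c0" "q \<longlonglongrightarrow> d0"
    using X unfolding p_def q_def c0_def d0_def by (auto intro: tendsto_fst tendsto_snd)
  have "(\<lambda>n. jost_scaled j (p n) (q n)) \<longlonglongrightarrow> jost_scaled j c0 d0"
    unfolding jost_scaled_def laplace_def set_lebesgue_integral_def
  proof (rule integral_dominated_convergence)
    show "integrable lborel (\<lambda>u. indicat_real {0<..} u *\<^sub>R (exp (pi * \<bar>\<eta>\<bar>) * (exp (- (1 * u)) * (u + 2) powr (2 * a - 1))))"
      using set_integrable_mult_right[OF set_integrable_exp_shifted_powr[of "2 * a - 1" 1]] a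
      unfolding set_integrable_def by simp
    show "(\<lambda>u. indicat_real {0<..} u *\<^sub>R exp (- (1 * u)) *\<^sub>R u ^ j *\<^sub>R jost_kernel c0 d0 u) \<in> borel_measurable lborel"
      by measurable
    show "(\<lambda>u. indicat_real {0<..} u *\<^sub>R exp (- (1 * u)) *\<^sub>R u ^ j *\<^sub>R jost_kernel (p n) (q n) u) \<in> borel_measurable lborel" for n
      by measurable
    show "AE u in lborel. (\<lambda>n. indicat_real {0<..} u *\<^sub>R exp (- (1 * u)) *\<^sub>R u ^ j *\<^sub>R jost_kernel (p n) (q n) u)
        \<longlonglongrightarrow> indicat_real {0<..} u *\<^sub>R exp (- (1 * u)) *\<^sub>R u ^ j *\<^sub>R jost_kernel c0 d0 u"
    proof (intro AE_I2)
      fix u :: real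
      show "(\<lambda>n. indicat_real {0<..} u *\<^sub>R exp (- (1 * u)) *\<^sub>R u ^ j *\<^sub>R jost_kernel (p n) (q n) u)
        \<longlonglongrightarrow> indicat_real {0<..} u *\<^sub>R exp (- (1 * u)) *\<^sub>R u ^ j *\<^sub>R jost_kernel c0 d0 u"
      proof (cases "u > 0")
        case True
        have "of_real (c0 * u) + 2 * \<i> * of_real d0 \<notin> \<real>\<^sub>\<le>\<^sub>0"
          using nz True by (auto simp: complex_nonpos_Reals_iff mult_le_0_iff)
        hence "(\<lambda>n. jost_kernel (p n) (q n) u) \<longlonglongrightarrow> jost_kernel c0 d0 u"
          unfolding jost_kernel_def
          by (intro tendsto_mult[OF tendsto_const] tendsto_powr_complex tendsto_intros lims)
        thus ?thesis by (intro tendsto_intros)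
      qed simp
    qed
    show "AE u in lborel. norm (indicat_real {0<..} u *\<^sub>R exp (- (1 * u)) *\<^sub>R u ^ j *\<^sub>R jost_kernel (p n) (q n) u)
       \<le> indicat_real {0<..} u *\<^sub>R (exp (pi * \<bar>\<eta>\<bar>) * (exp (- (1 * u)) * (u + 2) powr (2 * a - 1)))" for n
    proof (intro AE_I2)
      fix u :: real
      have "u ^ j * norm (jost_kernel (p n) (q n) u) \<le> exp (pi * \<bar>\<eta>\<bar>) * (u + 2) powr (2 * a - 1)" if u: "u > 0"
      proof -
        have "u ^ j \<le> (u + 2) powr 1" using j u by (cases j) auto
        hence "u ^ j * norm (jost_kernel (p n) (q n) u) \<le> (u + 2) powr 1 * (exp (pi * \<bar>\<eta>\<bar>) * (u + 2) powr (2 * a - 2))"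
          using u pq by (intro mult_mono norm_jost_kernel_le) auto
        also have "\<dots> = exp (pi * \<bar>\<eta>\<bar>) * ((u + 2) powr 1 * (u + 2) powr (2 * a - 2))" by simp
        also have "(u + 2) powr 1 * (u + 2) powr (2 * a - 2) = (u + 2) powr (2 * a - 1)"
          unfolding powr_add[symmetric] by simp
        finally show ?thesis .
      qed
      thus "norm (indicat_real {0<..} u *\<^sub>R exp (- (1 * u)) *\<^sub>R u ^ j *\<^sub>R jost_kernel (p n) (q n) u)
       \<le> indicat_real {0<..} u *\<^sub>R (exp (pi * \<bar>\<eta>\<bar>) * (exp (- (1 * u)) * (u + 2) powr (2 * a - 1)))"
        by (auto simp: indicator_def mult.left_commute[of "exp (pi * \<bar>\<eta>\<bar>)"])
    qed
  qed
  thus "((\<lambda>(c, d). jost_scaled j c d) \<circ> X) \<longlonglongrightarrow> (\<lambda>(c, d). jost_scaled j c d) l"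
    by (simp add: o_def p_def q_def c0_def d0_def case_prod_beta)
qed

lemma jost_scaled_at_infinity:
  "jost_scaled 0 0 1 = Gamma (Complex a (- \<eta>)) * (2 * \<i>) powr (Complex a \<eta> - 1)"
proof -
  have "jost_scaled 0 0 1 = (LINT u:{0<..}|lborel. (exp (- (1 * u)) *\<^sub>R of_real u powr (Complex a (- \<eta>) - 1)) * (2 * \<i>) powr (Complex a \<eta> - 1))"
    by (simp add: jost_scaled_def laplace_def jost_kernel_def scaleR_conv_of_real mult.assoc)
  also have "\<dots> = laplace (\<lambda>u. of_real u powr (Complex a (- \<eta>) - 1)) 1 * (2 * \<i>) powr (Complex a \<eta> - 1)"
    unfolding laplace_def by (rule set_integral_mult_left)
  finally show ?thesis using a by (simp add: Gamma_laplace)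
qed

lemma jost_scaled_at_zero: "jost_scaled 1 1 0 = of_real (Gamma (2 * a))"
proof -
  have "jost_scaled 1 1 0 = laplace (\<lambda>u. of_real u powr (of_real (2 * a) - 1)) 1"
    unfolding jost_scaled_def laplace_def
  proof (rule set_lebesgue_integral_cong)
    show "\<forall>u. u \<in> {0<..} \<longrightarrow> exp (- (1 * u)) *\<^sub>R u ^ 1 *\<^sub>R jost_kernel 1 0 u =
            exp (- (1 * u)) *\<^sub>R complex_of_real u powr (of_real (2 * a) - 1)"
    proof (intro allI impI)
      fix u :: real assume "u \<in> {0<..}"
      hence u: "u > 0" by simp
      have "u *\<^sub>R jost_kernel 1 0 u = of_real u powr 1 * (of_real u powr (Complex a (- \<eta>) - 1) * of_real u powr (Complex a \<eta> - 1))"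
        using u by (simp add: jost_kernel_def scaleR_conv_of_real powr_to_1)
      also have "\<dots> = of_real u powr (1 + (Complex a (- \<eta>) - 1 + (Complex a \<eta> - 1)))"
        by (simp only: powr_add)
      also have "1 + (Complex a (- \<eta>) - 1 + (Complex a \<eta> - 1)) = of_real (2 * a) - 1"
        by (simp add: complex_eq_iff)
      finally show "exp (- (1 * u)) *\<^sub>R u ^ 1 *\<^sub>R jost_kernel 1 0 u =
            exp (- (1 * u)) *\<^sub>R complex_of_real u powr (of_real (2 * a) - 1)" by simp
    qed
  qed auto
  thus ?thesis using a by (simp add: Gamma_laplace Gamma_complex_of_real flip: of_real_mult)
qed

end

end

context
  fixes a \<eta> :: real
  assumes a: "a \<ge> 1"
begin

lemma jost_admissible: "laplace_admissible (\<lambda>s. s ^ j *\<^sub>R jost_kernel a \<eta> 1 1 s)"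
proof (induction j)
  case 0
  show ?case using jost_kernel_admissible[OF a] by simp
next
  case (Suc j)
  show ?case using laplace_admissible_mult[OF Suc] by simp
qed

lemma jost_has_vector_derivative:
  assumes "x > 0"
  shows "(jost a \<eta> j has_vector_derivative - jost a \<eta> (Suc j) x) (at x)"
  using laplace_has_vector_derivative[OF jost_admissible assms, of j]
  by (simp add: jost_def[abs_def])

text \<open>
The combination of transforms is the integral over the half line of the derivative of
\<open>exp (- x s) * s powr (a - \<i> \<eta>) * (s + 2 \<i>) powr (a + \<i> \<eta>)\<close>, which vanishes at both ends.
\<close>

lemma jost_ode:
  assumes x: "x > 0"
  shows "of_real x * jost a \<eta> 2 x + 2 * \<i> * of_real x * jost a \<eta> 1 x =
           2 * of_real a * jost a \<eta> 1 x + 2 * \<i> * Complex a (- \<eta>) * jost a \<eta> 0 x"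
proof -
  let ?B = "Complex a (- \<eta>)" and ?A = "Complex a \<eta>"
  let ?k = "jost_kernel a \<eta> 1 1"
  define G where "G s = exp (- (x * s)) *\<^sub>R (of_real s powr ?B * (of_real s + 2 * \<i>) powr ?A)" for s
  define P where "P s = - of_real x * (of_real s * (of_real s + 2 * \<i>)) + ?B * (of_real s + 2 * \<i>) + ?A * of_real s"
    for s :: real
  define g where "g s = exp (- (x * s)) *\<^sub>R (P s * ?k s)" for s
  have int: "set_integrable lborel {0<..} (\<lambda>s. exp (- (x * s)) *\<^sub>R s ^ j *\<^sub>R ?k s)" for j
    using jost_admissible[of j] x by (auto simp: laplace_admissible_def)
  have g_expand: "g s = (- of_real x) * (exp (- (x * s)) *\<^sub>R s ^ 2 *\<^sub>R ?k s) +
      (2 * of_real a - 2 * \<i> * of_real x) * (exp (- (x * s)) *\<^sub>R s ^ 1 *\<^sub>R ?k s) +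
      (2 * \<i> * ?B) * (exp (- (x * s)) *\<^sub>R s ^ 0 *\<^sub>R ?k s)" for s
  proof -
    \<comment> \<open>the exponents add up to a real number, which is where the coefficient of the first derivative comes from\<close>
    have AB: "?A = 2 * of_real a - ?B" by (simp add: complex_eq_iff)
    show ?thesis unfolding g_def P_def AB
      by (simp add: scaleR_conv_of_real power2_eq_square algebra_simps)
  qed
  have g_int: "set_integrable lborel {0<..} g"
    unfolding g_expand by (intro set_integral_add set_integrable_mult_right int)
  have "(LINT s:{0<..}|lborel. g s) = (- of_real x) * jost a \<eta> 2 x +
      (2 * of_real a - 2 * \<i> * of_real x) * jost a \<eta> 1 x + (2 * \<i> * ?B) * jost a \<eta> 0 x"
    unfolding g_expand
    by (subst set_integral_add(2), (intro set_integral_add(1) set_integrable_mult_right int)+)+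
       (simp only: set_integral_mult_right jost_def laplace_def)
  moreover have "(LINT s:{0<..}|lborel. g s) = 0"
  proof -
    have deriv: "(G has_vector_derivative g s) (at s)" if s: "s > 0" for s
    proof -
      have nz: "complex_of_real s \<notin> \<real>\<^sub>\<le>\<^sub>0" "complex_of_real s + 2 * \<i> \<notin> \<real>\<^sub>\<le>\<^sub>0"
        using s by (auto simp: complex_nonpos_Reals_iff)
      define H where "H z = exp (- (of_real x * z)) * (z powr ?B * (z + 2 * \<i>) powr ?A)" for z :: complex
      define S where "S = complex_of_real s"
      have S: "S \<notin> \<real>\<^sub>\<le>\<^sub>0" "S + 2 * \<i> \<notin> \<real>\<^sub>\<le>\<^sub>0" using nz by (simp_all add: S_def)
      have "(H has_field_derivative exp (- (of_real x * S)) * (- of_real x) * (S powr ?B * (S + 2 * \<i>) powr ?A) +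
          exp (- (of_real x * S)) * (?B * S powr (?B - 1) * (S + 2 * \<i>) powr ?A +
             S powr ?B * (?A * (S + 2 * \<i>) powr (?A - 1)))) (at S)"
        unfolding H_def using S
        by (auto intro!: derivative_eq_intros simp: algebra_simps)
      also have "S powr ?B = S * S powr (?B - 1)"
        using S(1) powr_add[of S 1 "?B - 1"] by (auto simp: powr_to_1)
      also have "(S + 2 * \<i>) powr ?A = (S + 2 * \<i>) * (S + 2 * \<i>) powr (?A - 1)"
        using S(2) powr_add[of "S + 2 * \<i>" 1 "?A - 1"] by (auto simp: powr_to_1)
      also have "exp (- (of_real x * S)) * (- of_real x) * (S * S powr (?B - 1) * ((S + 2 * \<i>) * (S + 2 * \<i>) powr (?A - 1))) +
          exp (- (of_real x * S)) * (?B * S powr (?B - 1) * ((S + 2 * \<i>) * (S + 2 * \<i>) powr (?A - 1)) +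
             S * S powr (?B - 1) * (?A * (S + 2 * \<i>) powr (?A - 1))) = g s"
        by (simp add: g_def P_def jost_kernel_def S_def scaleR_conv_of_real algebra_simps flip: exp_of_real)
      finally have "(H has_field_derivative g s) (at (of_real s))" by (simp add: S_def)
      hence "((\<lambda>t. H (of_real t)) has_vector_derivative g s) (at s)"
        by (rule has_vector_derivative_real_field)
      also have "(\<lambda>t. H (of_real t)) = G"
        by (rule ext) (simp add: H_def G_def scaleR_conv_of_real flip: exp_of_real)
      finally show ?thesis .
    qed
    have cont: "isCont g s" if s: "s > 0" for s
    proof -
      define u where "u s = complex_of_real s powr (?B - 1)" for s
      define v where "v s = (complex_of_real (1 * s) + 2 * \<i> * of_real 1) powr (?A - 1)" for s
      have "isCont u s" unfolding u_def using s
        by (intro isCont_powr_complex continuous_of_real continuous_ident continuous_const)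
           (auto simp: complex_nonpos_Reals_iff)
      moreover have "isCont v s" unfolding v_def using s
        by (intro isCont_powr_complex continuous_add continuous_of_real continuous_mult
              continuous_ident continuous_const) (auto simp: complex_nonpos_Reals_iff)
      ultimately have "isCont (\<lambda>s. exp (- (x * s)) *\<^sub>R (P s * (u s * v s))) s"
        unfolding P_def by (intro continuous_intros)
      thus ?thesis by (simp add: g_def[abs_def] jost_kernel_def u_def v_def)
    qed
    have Gbound: "norm (G s) \<le> exp (- (x * s)) * (s powr a * (exp (pi * \<bar>\<eta>\<bar>) * (s + 2) powr a))" if s: "s > 0" for s
    proof -
      have "cmod ((of_real s + 2 * \<i>) powr ?A) \<le> exp (pi * \<bar>\<eta>\<bar>) * (s + 2) powr a"
      proof -
        have "Complex (a + 1) \<eta> - 1 = Complex a \<eta>" by (simp add: complex_eq_iff)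
        thus ?thesis using norm_shifted_powr_le[of "a + 1" s 1 1 \<eta>] s a by simp
      qed
      moreover have "cmod (of_real s powr ?B) = s powr a" using s by (subst norm_powr_real_powr) auto
      ultimately show ?thesis
        unfolding G_def norm_scaleR norm_mult by (auto intro!: mult_left_mono)
    qed
    have lim0: "(G \<longlongrightarrow> 0) (at_right 0)"
    proof (rule Lim_null_comparison)
      show "\<forall>\<^sub>F s in at_right 0. norm (G s) \<le> exp (- (x * s)) * (s powr a * (exp (pi * \<bar>\<eta>\<bar>) * (s + 2) powr a))"
        using Gbound by (auto simp: eventually_at_right_field intro: exI[of _ 1])
      have "((\<lambda>s. exp (- (x * s)) * (s powr a * (exp (pi * \<bar>\<eta>\<bar>) * (s + 2) powr a))) \<longlongrightarrow>
           exp (- (x * 0)) * (0 powr a * (exp (pi * \<bar>\<eta>\<bar>) * (0 + 2) powr a))) (at_right 0)"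
      proof (intro tendsto_mult)
        show "((\<lambda>s. s powr a) \<longlongrightarrow> 0 powr a) (at_right 0)"
          using a by (intro tendsto_powr' tendsto_const tendsto_ident_at)
             (auto simp: eventually_at_right_field intro: exI[of _ 1])
        show "((\<lambda>s. (s + 2) powr a) \<longlongrightarrow> (0 + 2) powr a) (at_right 0)"
          by (intro tendsto_powr tendsto_add tendsto_ident_at tendsto_const) auto
        show "((\<lambda>s. exp (- (x * s))) \<longlongrightarrow> exp (- (x * 0))) (at_right 0)"
          by (intro tendsto_intros)
      qed auto
      thus "((\<lambda>s. exp (- (x * s)) * (s powr a * (exp (pi * \<bar>\<eta>\<bar>) * (s + 2) powr a))) \<longlongrightarrow> 0) (at_right 0)"
        by simp
    qed
    obtain C where C: "\<And>s. s \<ge> 0 \<Longrightarrow> (s + 2) powr (2 * a) \<le> C * exp (x / 2 * s)"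
      using shifted_powr_le_exp[of "2 * a" "x / 2"] a x by auto
    have lim1: "(G \<longlongrightarrow> 0) at_top"
    proof (rule Lim_null_comparison)
      show "\<forall>\<^sub>F s in at_top. norm (G s) \<le> exp (pi * \<bar>\<eta>\<bar>) * C * exp (- (x / 2 * s))"
        using eventually_gt_at_top[of 0]
      proof eventually_elim
        case (elim s)
        have "s powr a * (s + 2) powr a \<le> (s + 2) powr a * (s + 2) powr a"
          using elim a by (intro mult_right_mono powr_mono2) auto
        also have "\<dots> = (s + 2) powr (2 * a)" by (simp flip: powr_add)
        also have "\<dots> \<le> C * exp (x / 2 * s)" using C elim by simp
        finally have "exp (- (x * s)) * exp (pi * \<bar>\<eta>\<bar>) * (s powr a * (s + 2) powr a) \<le>
             exp (- (x * s)) * exp (pi * \<bar>\<eta>\<bar>) * (C * exp (x / 2 * s))"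
          by (intro mult_left_mono) auto
        also have "\<dots> = exp (pi * \<bar>\<eta>\<bar>) * C * (exp (- (x * s)) * exp (x / 2 * s))" by simp
        also have "exp (- (x * s)) * exp (x / 2 * s) = exp (- (x / 2 * s))" by (simp flip: exp_add add: field_simps)
        finally have "exp (- (x * s)) * exp (pi * \<bar>\<eta>\<bar>) * (s powr a * (s + 2) powr a) \<le>
             exp (pi * \<bar>\<eta>\<bar>) * C * exp (- (x / 2 * s))" .
        moreover have "norm (G s) \<le> exp (- (x * s)) * exp (pi * \<bar>\<eta>\<bar>) * (s powr a * (s + 2) powr a)"
          using Gbound[OF elim] by (simp only: mult_ac)
        ultimately show ?case by (rule order_trans[rotated])
      qed
      have "((\<lambda>s. exp (- (x / 2 * s))) \<longlongrightarrow> 0) at_top"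
        using x by (intro filterlim_compose[OF exp_at_bot] filterlim_uminus_at_bot_at_top[THEN filterlim_compose]
           filterlim_tendsto_pos_mult_at_top[OF tendsto_const _ filterlim_ident]) auto
      thus "((\<lambda>s. exp (pi * \<bar>\<eta>\<bar>) * C * exp (- (x / 2 * s))) \<longlongrightarrow> 0) at_top"
        by (rule tendsto_mult_right_zero)
    qed
    have "(LBINT s=0..\<infinity>. g s) = 0 - 0"
    proof (rule interval_integral_FTC_integrable)
      show "((G \<circ> real_of_ereal) \<longlongrightarrow> 0) (at_right 0)"
        using lim0 by (simp add: ereal_tendsto_simps zero_ereal_def)
      show "((G \<circ> real_of_ereal) \<longlongrightarrow> 0) (at_left \<infinity>)"
        using lim1 by (simp add: ereal_tendsto_simps)
      have "einterval 0 \<infinity> = {0<..}" by (auto simp: einterval_def)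
      thus "set_integrable lborel (einterval 0 \<infinity>) g" using g_int by simp
    qed (use deriv cont in \<open>auto\<close>)
    moreover have "einterval 0 \<infinity> = {0<..}" by (auto simp: einterval_def)
    ultimately show ?thesis by (simp add: interval_lebesgue_integral_def)
  qed
  ultimately show ?thesis by (simp add: algebra_simps)
qed

text \<open>
In terms of the kernel at \<open>(1, x)\<close>, the second limit is a Gamma integral because the two complex powers of
\<open>u\<close> combine to a real one at \<open>(1, 0)\<close>.  In the first limit a factor \<open>x\<close> remains in front of a convergent
expression.
\<close>

lemma jost_near_zero:
  "((\<lambda>x. of_real (x powr (2 * a)) * jost a \<eta> 0 x) \<longlongrightarrow> 0) (at_right 0)"
  "((\<lambda>x. of_real (x powr (2 * a)) * jost a \<eta> 1 x) \<longlongrightarrow> of_real (Gamma (2 * a))) (at_right 0)"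
proof -
  have lim: "((\<lambda>x. jost_scaled a \<eta> j 1 x) \<longlongrightarrow> jost_scaled a \<eta> j 1 0) (at_right 0)" if "j \<le> 1" for j
  proof -
    have "((\<lambda>x. (\<lambda>(c, d). jost_scaled a \<eta> j c d) (1, x)) \<longlongrightarrow> (\<lambda>(c, d). jost_scaled a \<eta> j c d) (1, 0)) (at_right 0)"
    proof (rule continuous_on_tendsto_compose[OF continuous_on_jost_scaled[OF a that]])
      show "((\<lambda>x. (1 :: real, x :: real)) \<longlongrightarrow> (1, 0)) (at_right 0)"
        by (intro tendsto_intros)
      show "\<forall>\<^sub>F x :: real in at_right 0. (1 :: real, x) \<in> {0..1} \<times> {0..1} - {(0, 0)}"
        by (auto simp: eventually_at_right_field intro!: exI[of _ 1])
    qed auto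
    thus ?thesis by simp
  qed
  have eq: "of_real (x powr (2 * a)) * jost a \<eta> j x = of_real x powi (1 - int j) * jost_scaled a \<eta> j 1 x" if x: "x > 0" for x j
  proof -
    have "of_real (x powr (2 * a)) * complex_of_real x powr (1 - of_real (2 * a)) = of_real x"
      using x by (simp add: powr_diff flip: powr_of_real)
    thus ?thesis unfolding jost_eq_scaled(2)[OF x]
      using x by (simp add: power_int_diff power_int_minus divide_inverse flip: mult.assoc)
  qed
  have "((\<lambda>x. of_real x * jost_scaled a \<eta> 0 1 x) \<longlongrightarrow> 0) (at_right 0)"
    using tendsto_mult[OF tendsto_of_real[OF tendsto_ident_at, where 'a = complex] lim[of 0]] by simp
  moreover have "\<forall>\<^sub>F x in at_right 0. of_real (x powr (2 * a)) * jost a \<eta> 0 x = of_real x * jost_scaled a \<eta> 0 1 x"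
    using eq[where j = 0] by (auto simp: eventually_at_right_field intro: exI[of _ 1])
  ultimately show "((\<lambda>x. of_real (x powr (2 * a)) * jost a \<eta> 0 x) \<longlongrightarrow> 0) (at_right 0)"
    by (simp only: tendsto_cong One_nat_def)
  have "((\<lambda>x. jost_scaled a \<eta> 1 1 x) \<longlongrightarrow> of_real (Gamma (2 * a))) (at_right 0)"
    using lim[of 1] jost_scaled_at_zero[OF a] by simp
  moreover have "\<forall>\<^sub>F x in at_right 0. of_real (x powr (2 * a)) * jost a \<eta> 1 x = jost_scaled a \<eta> 1 1 x"
    using eq[where j = 1] by (auto simp: eventually_at_right_field intro: exI[of _ 1])
  ultimately show "((\<lambda>x. of_real (x powr (2 * a)) * jost a \<eta> 1 x) \<longlongrightarrow> of_real (Gamma (2 * a))) (at_right 0)"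
    by (simp only: tendsto_cong One_nat_def)
qed

text \<open>
In terms of the kernel at \<open>(1 / x, 1)\<close>, the second power becomes the constant
\<open>(2 \<i>) powr (a - 1 + \<i> \<eta>)\<close> in the limit, whose argument \<open>pi / 2\<close> produces the factor \<open>exp (- pi \<eta> / 2)\<close>.
\<close>

lemma jost_at_infinity:
  "((\<lambda>x. x powr a * cmod (jost a \<eta> 0 x)) \<longlongrightarrow>
      cmod (Gamma (Complex a \<eta>)) * (2 powr (a - 1) * exp (- (pi * \<eta> / 2)))) at_top"
  "((\<lambda>x. of_real (x powr a) * jost a \<eta> 1 x) \<longlongrightarrow> 0) at_top"
proof -
  have lim: "((\<lambda>x. jost_scaled a \<eta> j (1 / x) 1) \<longlongrightarrow> jost_scaled a \<eta> j 0 1) at_top" if "j \<le> 1" for j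
  proof -
    have "((\<lambda>x. (\<lambda>(c, d). jost_scaled a \<eta> j c d) (1 / x, 1)) \<longlongrightarrow> (\<lambda>(c, d). jost_scaled a \<eta> j c d) (0, 1)) at_top"
    proof (rule continuous_on_tendsto_compose[OF continuous_on_jost_scaled[OF a that]])
      show "((\<lambda>x :: real. (1 / x, 1 :: real)) \<longlongrightarrow> (0, 1)) at_top"
        by (intro tendsto_Pair tendsto_const real_tendsto_divide_at_top[OF tendsto_const filterlim_ident])
      show "\<forall>\<^sub>F x :: real in at_top. (1 / x, 1 :: real) \<in> {0..1} \<times> {0..1} - {(0, 0)}"
        using eventually_ge_at_top[of 1] by eventually_elim auto
    qed auto
    thus ?thesis by simp
  qed
  have eq: "x powr a * cmod (jost a \<eta> j x) = cmod (jost_scaled a \<eta> j (1 / x) 1) / x ^ j" if x: "x > 0" for x j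
  proof -
    have "cmod (complex_of_real x powr (- Complex a (- \<eta>))) = x powr (- a)"
      using x by (subst norm_powr_real_powr) auto
    hence "cmod (jost a \<eta> j x) = x powr (- a) * (cmod (jost_scaled a \<eta> j (1 / x) 1) / x ^ j)"
      unfolding jost_eq_scaled(1)[OF x] norm_mult
      using x by (simp only: power_int_minus power_int_of_nat norm_inverse norm_power norm_of_real) (simp add: field_simps)
    thus ?thesis using x by (simp add: powr_minus)
  qed
  have "((\<lambda>x. cmod (jost_scaled a \<eta> 0 (1 / x) 1)) \<longlongrightarrow> cmod (jost_scaled a \<eta> 0 0 1)) at_top"
    by (intro tendsto_intros lim) auto
  moreover have "\<forall>\<^sub>F x in at_top. x powr a * cmod (jost a \<eta> 0 x) = cmod (jost_scaled a \<eta> 0 (1 / x) 1)"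
    using eventually_gt_at_top[of 0] by eventually_elim (simp add: eq)
  moreover have "cmod (jost_scaled a \<eta> 0 0 1) = cmod (Gamma (Complex a \<eta>)) * (2 powr (a - 1) * exp (- (pi * \<eta> / 2)))"
  proof -
    have "Gamma (Complex a (- \<eta>)) = cnj (Gamma (Complex a \<eta>))" by (simp add: cnj_Gamma complex_cnj flip: complex_cnj)
    moreover have "cmod ((2 * \<i>) powr (Complex a \<eta> - 1)) = 2 powr (a - 1) * exp (- (pi * \<eta> / 2))"
    proof -
      have "Arg (2 * \<i>) = pi / 2" using Arg_times_of_real[of 2 \<i>] by simp
      thus ?thesis by (simp add: norm_powr_complex norm_mult mult.commute)
    qed
    ultimately show ?thesis by (simp add: jost_scaled_at_infinity[OF a] norm_mult)
  qed
  ultimately show "((\<lambda>x. x powr a * cmod (jost a \<eta> 0 x)) \<longlongrightarrow>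
      cmod (Gamma (Complex a \<eta>)) * (2 powr (a - 1) * exp (- (pi * \<eta> / 2)))) at_top"
    by (simp only: tendsto_cong One_nat_def)
  have "((\<lambda>x. cmod (jost_scaled a \<eta> 1 (1 / x) 1) / x) \<longlongrightarrow> 0) at_top"
    by (rule real_tendsto_divide_at_top[OF tendsto_norm[OF lim] filterlim_ident]) simp
  moreover have "\<forall>\<^sub>F x in at_top. norm (of_real (x powr a) * jost a \<eta> 1 x) = cmod (jost_scaled a \<eta> 1 (1 / x) 1) / x"
    using eventually_gt_at_top[of 0] by eventually_elim (simp add: eq norm_mult)
  ultimately have "((\<lambda>x. norm (of_real (x powr a) * jost a \<eta> 1 x)) \<longlongrightarrow> 0) at_top"
    by (simp only: tendsto_cong One_nat_def)
  thus "((\<lambda>x. of_real (x powr a) * jost a \<eta> 1 x) \<longlongrightarrow> 0) at_top"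
    by (rule tendsto_norm_zero_cancel)
qed

end

section \<open>Amplitude of the regular solution at infinity\<close>

text \<open>
Abel's identity for the equation \<open>x y'' + 2 a y' + (x - 2 \<eta>) y = 0\<close>.
\<close>

lemma wronskian_constant:
  fixes y y' z z' :: "real \<Rightarrow> complex"
  assumes y: "\<And>x. x > 0 \<Longrightarrow> (y has_vector_derivative y' x) (at x)"
      "\<And>x. x > 0 \<Longrightarrow> (y' has_vector_derivative
          ((2 * of_real \<eta> - of_real x) * y x - 2 * of_real a * y' x) / of_real x) (at x)"
    and z: "\<And>x. x > 0 \<Longrightarrow> (z has_vector_derivative z' x) (at x)"
      "\<And>x. x > 0 \<Longrightarrow> (z' has_vector_derivative
          ((2 * of_real \<eta> - of_real x) * z x - 2 * of_real a * z' x) / of_real x) (at x)"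
  obtains w where "\<And>x. x > 0 \<Longrightarrow> of_real (x powr (2 * a)) * (y x * z' x - y' x * z x) = w"
proof -
  let ?W = "\<lambda>x. complex_of_real (x powr (2 * a)) * (y x * z' x - y' x * z x)"
  have "(?W has_vector_derivative 0) (at x within {0<..})" if "x \<in> {0<..}" for x
  proof -
    have x: "x > 0" using that by simp
    have p: "((\<lambda>x. x powr (2 * a)) has_real_derivative 2 * a * x powr (2 * a) / x) (at x)"
      using x by (auto intro!: derivative_eq_intros simp: powr_diff)
    have p': "((\<lambda>x. complex_of_real (x powr (2 * a))) has_vector_derivative of_real (2 * a * x powr (2 * a) / x)) (at x)"
      by (rule has_vector_derivative_of_real[OF p])
    let ?D = "complex_of_real (x powr (2 * a)) *
           ((y x * (((2 * of_real \<eta> - of_real x) * z x - 2 * of_real a * z' x) / of_real x) + y' x * z' x) -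
            (y' x * z' x + ((2 * of_real \<eta> - of_real x) * y x - 2 * of_real a * y' x) / of_real x * z x)) +
          of_real (2 * a * x powr (2 * a) / x) * (y x * z' x - y' x * z x)"
    have W: "(?W has_vector_derivative ?D) (at x)"
      by (intro has_vector_derivative_mult p' has_vector_derivative_diff y z x)
    have D: "?D = 0" by (simp add: divide_inverse algebra_simps)
    show ?thesis using W unfolding D by (rule has_vector_derivative_at_within)
  qed
  then obtain w where "\<And>x. x \<in> {0<..} \<Longrightarrow> ?W x = w"
    using has_vector_derivative_zero_constant[of "{0<..}" ?W] by auto
  thus ?thesis using that by auto
qed

context
  fixes a \<eta> :: real
  assumes a: "a \<ge> 1"
begin

text \<open>
With \<open>y = exp (- \<i> x) h\<close>, the functions \<open>\<phi>\<close>, \<open>y\<close> and the conjugate of \<open>y\<close> solve the same equation.  The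
Wronskian \<open>w\<close> of \<open>\<phi>\<close> and \<open>y\<close> is \<open>- Gamma (2 a)\<close> by the limits at the origin, and the Wronskian \<open>v\<close> of the
conjugate of \<open>y\<close> and \<open>y\<close> is \<open>- 2 \<i> \<rho>\<^sup>2\<close> by the limits at infinity, where \<open>\<rho>\<close> is the limit of
\<open>x powr a * \<bar>h\<bar>\<close>.  As \<open>w\<close> is real, the Pluecker relation \<open>v \<phi> = w (cnj y - y)\<close> and its analogue for the
derivatives show that \<open>\<phi>\<close> and \<open>\<phi>'\<close> are \<open>- Gamma (2 a) / \<rho>\<^sup>2\<close> times the imaginary parts of \<open>y\<close> and \<open>y'\<close>.
Finally \<open>x powr a * (y' + \<i> y)\<close> tends to \<open>0\<close>, so that after weighting with \<open>x powr a\<close> the imaginary part of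
\<open>y'\<close> is close to minus the real part of \<open>y\<close>, and the sum of the squares tends to \<open>(Gamma (2 a) / \<rho>)\<^sup>2\<close>.
\<close>

lemma coulomb_series_amplitude:
  "((\<lambda>x. (x powr a * coulomb_series a \<eta> x)\<^sup>2 + (x powr a * coulomb_series' a \<eta> x)\<^sup>2) \<longlongrightarrow>
     (Gamma (2 * a) / (cmod (Gamma (Complex a \<eta>)) * (2 powr (a - 1) * exp (- (pi * \<eta> / 2)))))\<^sup>2) at_top"
proof -
  define \<rho> where "\<rho> = cmod (Gamma (Complex a \<eta>)) * (2 powr (a - 1) * exp (- (pi * \<eta> / 2)))"
  define \<phi> \<phi>' where "\<phi> = (\<lambda>x. complex_of_real (coulomb_series a \<eta> x))" and
    "\<phi>' = (\<lambda>x. complex_of_real (coulomb_series' a \<eta> x))"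
  define e where "e x = exp (- \<i> * complex_of_real x)" for x
  define y where "y x = e x * jost a \<eta> 0 x" for x
  define y' where "y' x = e x * (- jost a \<eta> 1 x - \<i> * jost a \<eta> 0 x)" for x
  have a': "a > -1/2" "a \<noteq> 0" using a by auto
  have e': "(e has_vector_derivative - \<i> * e x) (at x)" for x
  proof -
    have "((\<lambda>z. exp (- \<i> * z)) has_field_derivative - \<i> * exp (- \<i> * of_real x)) (at (of_real x))"
      by (auto intro!: derivative_eq_intros)
    thus ?thesis unfolding e_def by (rule has_vector_derivative_real_field)
  qed
  have [simp]: "norm (e x) = 1" for x by (simp add: e_def)
  have Y: "(y has_vector_derivative y' x) (at x)"
     "(y' has_vector_derivative ((2 * of_real \<eta> - of_real x) * y x - 2 * of_real a * y' x) / of_real x) (at x)"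
    if x: "x > 0" for x
  proof -
    note j = jost_has_vector_derivative[OF a x, of \<eta>]
    have "(y has_vector_derivative e x * (- jost a \<eta> (Suc 0) x) + - \<i> * e x * jost a \<eta> 0 x) (at x)"
      unfolding y_def by (intro has_vector_derivative_mult e' j)
    thus "(y has_vector_derivative y' x) (at x)" by (simp add: y'_def algebra_simps)
    have "(y' has_vector_derivative e x * (- (- jost a \<eta> (Suc 1) x) - \<i> * (- jost a \<eta> (Suc 0) x)) +
         - \<i> * e x * (- jost a \<eta> 1 x - \<i> * jost a \<eta> 0 x)) (at x)"
      unfolding y'_def
      by (intro has_vector_derivative_mult e' has_vector_derivative_diff has_vector_derivative_minus j
             has_vector_derivative_mult_right)
    also have "e x * (- (- jost a \<eta> (Suc 1) x) - \<i> * (- jost a \<eta> (Suc 0) x)) +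
         - \<i> * e x * (- jost a \<eta> 1 x - \<i> * jost a \<eta> 0 x) =
         e x * (jost a \<eta> 2 x + 2 * \<i> * jost a \<eta> 1 x - jost a \<eta> 0 x)"
      by (simp add: algebra_simps numeral_2_eq_2)
    also have "\<dots> = ((2 * of_real \<eta> - of_real x) * y x - 2 * of_real a * y' x) / of_real x"
    proof -
      have B: "Complex a (- \<eta>) = of_real a - \<i> * of_real \<eta>" by (simp add: complex_eq_iff)
      have "of_real x * (jost a \<eta> 2 x + 2 * \<i> * jost a \<eta> 1 x - jost a \<eta> 0 x) =
        (2 * of_real \<eta> - of_real x) * jost a \<eta> 0 x + 2 * of_real a * (jost a \<eta> 1 x + \<i> * jost a \<eta> 0 x)"
        using jost_ode[OF a x, of \<eta>] unfolding B by (simp add: algebra_simps)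
      hence "of_real x * (e x * (jost a \<eta> 2 x + 2 * \<i> * jost a \<eta> 1 x - jost a \<eta> 0 x)) =
        (2 * of_real \<eta> - of_real x) * y x - 2 * of_real a * y' x"
        unfolding y_def y'_def by algebra
      thus ?thesis using x by (simp add: field_simps)
    qed
    finally show "(y' has_vector_derivative ((2 * of_real \<eta> - of_real x) * y x - 2 * of_real a * y' x) / of_real x) (at x)" .
  qed
  have cY: "((\<lambda>x. cnj (y x)) has_vector_derivative cnj (y' x)) (at x)"
     "((\<lambda>x. cnj (y' x)) has_vector_derivative ((2 * of_real \<eta> - of_real x) * cnj (y x) - 2 * of_real a * cnj (y' x)) / of_real x) (at x)"
    if x: "x > 0" for x
    using has_vector_derivative_cnj[OF Y(1)[OF x]] has_vector_derivative_cnj[OF Y(2)[OF x]] by simp_all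
  have P: "(\<phi> has_vector_derivative \<phi>' x) (at x)"
     "(\<phi>' has_vector_derivative ((2 * of_real \<eta> - of_real x) * \<phi> x - 2 * of_real a * \<phi>' x) / of_real x) (at x)"
    if x: "x > 0" for x
  proof -
    have "(\<phi> has_vector_derivative of_real (coulomb_series' a \<eta> x)) (at x)" unfolding \<phi>_def
      by (intro has_vector_derivative_of_real deriv_coulomb_series[OF a'])
    thus "(\<phi> has_vector_derivative \<phi>' x) (at x)" by (simp add: \<phi>'_def)
    have "(\<phi>' has_vector_derivative of_real (((2 * \<eta> - x) * coulomb_series a \<eta> x - 2 * a * coulomb_series' a \<eta> x) / x)) (at x)"
      unfolding \<phi>'_def using x
      by (intro has_vector_derivative_of_real deriv_coulomb_series'[OF a']) auto
    thus "(\<phi>' has_vector_derivative ((2 * of_real \<eta> - of_real x) * \<phi> x - 2 * of_real a * \<phi>' x) / of_real x) (at x)"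
      by (simp add: \<phi>_def \<phi>'_def)
  qed
  obtain w where w: "\<And>x. x > 0 \<Longrightarrow> of_real (x powr (2 * a)) * (\<phi> x * y' x - \<phi>' x * y x) = w"
    using wronskian_constant[OF P Y] by blast
  obtain v where v: "\<And>x. x > 0 \<Longrightarrow> of_real (x powr (2 * a)) * (cnj (y x) * y' x - cnj (y' x) * y x) = v"
    using wronskian_constant[OF cY Y] by blast
  have w_eq: "w = - of_real (Gamma (2 * a))"
  proof -
    let ?q = "\<lambda>x. complex_of_real (x powr (2 * a))"
    have lim_phi: "(\<phi> \<longlongrightarrow> \<phi> 0) (at_right 0)" "(\<phi>' \<longlongrightarrow> \<phi>' 0) (at_right 0)" "(e \<longlongrightarrow> e 0) (at_right 0)"
    proof -
      have "isCont (coulomb_series a \<eta>) 0" using deriv_coulomb_series[OF a'] DERIV_isCont by blast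
      thus "(\<phi> \<longlongrightarrow> \<phi> 0) (at_right 0)" unfolding \<phi>_def
        by (intro tendsto_of_real) (auto simp: isCont_def intro: tendsto_within_subset)
      have "isCont (coulomb_series' a \<eta>) 0" by (rule isCont_coulomb_series'[OF a'])
      thus "(\<phi>' \<longlongrightarrow> \<phi>' 0) (at_right 0)" unfolding \<phi>'_def
        by (intro tendsto_of_real) (auto simp: isCont_def intro: tendsto_within_subset)
      show "(e \<longlongrightarrow> e 0) (at_right 0)" unfolding e_def by (intro tendsto_intros)
    qed
    have "((\<lambda>x. \<phi> x * (e x * (- (?q x * jost a \<eta> 1 x) - \<i> * (?q x * jost a \<eta> 0 x))) - \<phi>' x * (e x * (?q x * jost a \<eta> 0 x)))
         \<longlongrightarrow> \<phi> 0 * (e 0 * (- of_real (Gamma (2 * a)) - \<i> * 0)) - \<phi>' 0 * (e 0 * 0)) (at_right 0)"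
      by (intro tendsto_intros lim_phi jost_near_zero[OF a])
    moreover have "\<phi> 0 = 1" "e 0 = 1" by (simp_all add: \<phi>_def e_def)
    moreover have "\<forall>\<^sub>F x in at_right 0.
       \<phi> x * (e x * (- (?q x * jost a \<eta> 1 x) - \<i> * (?q x * jost a \<eta> 0 x))) - \<phi>' x * (e x * (?q x * jost a \<eta> 0 x)) = w"
      unfolding eventually_at_right_field
    proof (intro exI[of _ 1] conjI allI impI)
      fix x :: real assume "x > 0"
      thus "\<phi> x * (e x * (- (?q x * jost a \<eta> 1 x) - \<i> * (?q x * jost a \<eta> 0 x))) - \<phi>' x * (e x * (?q x * jost a \<eta> 0 x)) = w"
        using w[of x] by (simp add: y_def y'_def algebra_simps)
    qed simp
    ultimately have "((\<lambda>x. w) \<longlongrightarrow> - of_real (Gamma (2 * a))) (at_right (0::real))"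
      by (simp add: tendsto_cong)
    thus ?thesis by (simp add: tendsto_const_iff)
  qed
  define p where "p x = of_real (x powr a) * y x" for x
  define p' where "p' x = of_real (x powr a) * y' x" for x
  have lim_p: "((\<lambda>x. cmod (p x)) \<longlongrightarrow> \<rho>) at_top"
    using jost_at_infinity(1)[OF a, of \<eta>] by (simp add: p_def y_def norm_mult \<rho>_def)
  have lim_q: "((\<lambda>x. p' x + \<i> * p x) \<longlongrightarrow> 0) at_top"
  proof (rule tendsto_norm_zero_cancel)
    have "p' x + \<i> * p x = - (e x * (of_real (x powr a) * jost a \<eta> 1 x))" for x
      by (simp add: p_def p'_def y_def y'_def algebra_simps)
    thus "((\<lambda>x. norm (p' x + \<i> * p x)) \<longlongrightarrow> 0) at_top"
      using tendsto_norm[OF jost_at_infinity(2)[OF a, of \<eta>]] by (simp add: norm_mult)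
  qed
  have \<rho>: "\<rho> > 0"
  proof -
    have "Complex a \<eta> \<notin> \<int>\<^sub>\<le>\<^sub>0" using a by (auto simp: complex_eq_iff elim!: nonpos_Ints_cases)
    thus ?thesis by (simp add: \<rho>_def Gamma_eq_zero_iff)
  qed
  have sq: "complex_of_real (x powr (2 * a)) = of_real (x powr a) * of_real (x powr a)" for x :: real
    by (simp flip: of_real_mult powr_add)
  have v_eq: "v = - 2 * \<i> * of_real (\<rho>\<^sup>2)"
  proof -
    have lim1: "((\<lambda>x. cnj (p x) * (p' x + \<i> * p x)) \<longlongrightarrow> 0) at_top"
    proof (rule tendsto_norm_zero_cancel)
      show "((\<lambda>x. norm (cnj (p x) * (p' x + \<i> * p x))) \<longlongrightarrow> 0) at_top"
        using tendsto_mult[OF lim_p tendsto_norm[OF lim_q]] by (simp add: norm_mult)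
    qed
    have "((\<lambda>x. cnj (p x) * (p' x + \<i> * p x) - cnj (cnj (p x) * (p' x + \<i> * p x)) - 2 * \<i> * of_real ((cmod (p x))\<^sup>2))
        \<longlongrightarrow> 0 - cnj 0 - 2 * \<i> * of_real (\<rho>\<^sup>2)) at_top"
      by (intro tendsto_intros lim1 lim_p)
    moreover have "\<forall>\<^sub>F x in at_top. cnj (p x) * (p' x + \<i> * p x) - cnj (cnj (p x) * (p' x + \<i> * p x)) - 2 * \<i> * of_real ((cmod (p x))\<^sup>2) = v"
      using eventually_gt_at_top[of 0]
    proof eventually_elim
      case (elim x)
      have "v = cnj (p x) * p' x - cnj (p' x) * p x"
        using v[OF elim] unfolding sq by (simp add: p_def p'_def algebra_simps)
      thus ?case unfolding complex_norm_square by (simp add: algebra_simps)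
    qed
    ultimately have "((\<lambda>x :: real. v) \<longlongrightarrow> - 2 * \<i> * of_real (\<rho>\<^sup>2)) at_top"
      by (simp add: tendsto_cong)
    thus ?thesis by (simp add: tendsto_const_iff)
  qed
  define k where "k = Gamma (2 * a) / \<rho>\<^sup>2"
  have two_i: "- 2 * \<i> \<noteq> 0" by simp
  have cnj_diff: "cnj z - z = - 2 * \<i> * of_real (Im z)" for z
    by (simp add: complex_eq_iff)
  have rep: "x powr a * coulomb_series a \<eta> x = - k * Im (p x)"
       "x powr a * coulomb_series' a \<eta> x = - k * Im (p' x)" if x: "x > 0" for x
  proof -
    have W: "w = of_real (x powr a) * \<phi> x * p' x - of_real (x powr a) * \<phi>' x * p x"
      using w[OF x] unfolding sq by (simp add: p_def p'_def algebra_simps)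
    have cW: "w = of_real (x powr a) * \<phi> x * cnj (p' x) - of_real (x powr a) * \<phi>' x * cnj (p x)"
    proof -
      have "w = cnj w" by (simp add: w_eq)
      also have "\<dots> = of_real (x powr a) * \<phi> x * cnj (p' x) - of_real (x powr a) * \<phi>' x * cnj (p x)"
        unfolding W by (simp add: \<phi>_def \<phi>'_def)
      finally show ?thesis .
    qed
    \<comment> \<open>three pairwise Wronskians of three functions; eliminating between them is linear algebra\<close>
    have V: "v = cnj (p x) * p' x - cnj (p' x) * p x"
      using v[OF x] unfolding sq by (simp add: p_def p'_def algebra_simps)
    have "of_real (x powr a) * \<phi> x * v = w * (cnj (p x) - p x)"
      using W cW unfolding V by algebra
    hence "of_real (x powr a) * \<phi> x * (- 2 * \<i> * of_real (\<rho>\<^sup>2)) =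
        - of_real (Gamma (2 * a)) * (- 2 * \<i> * of_real (Im (p x)))"
      unfolding v_eq w_eq cnj_diff .
    hence "- 2 * \<i> * complex_of_real (x powr a * coulomb_series a \<eta> x * \<rho>\<^sup>2) =
        - 2 * \<i> * complex_of_real (- Gamma (2 * a) * Im (p x))"
      unfolding \<phi>_def of_real_mult of_real_minus by algebra
    hence "x powr a * coulomb_series a \<eta> x * \<rho>\<^sup>2 = - Gamma (2 * a) * Im (p x)"
      using two_i unfolding mult_cancel_left of_real_eq_iff by blast
    thus "x powr a * coulomb_series a \<eta> x = - k * Im (p x)" using \<rho> by (simp add: k_def field_simps)
    have "of_real (x powr a) * \<phi>' x * v = w * (cnj (p' x) - p' x)"
      using W cW unfolding V by algebra
    hence "of_real (x powr a) * \<phi>' x * (- 2 * \<i> * of_real (\<rho>\<^sup>2)) =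
        - of_real (Gamma (2 * a)) * (- 2 * \<i> * of_real (Im (p' x)))"
      unfolding v_eq w_eq cnj_diff .
    hence "- 2 * \<i> * complex_of_real (x powr a * coulomb_series' a \<eta> x * \<rho>\<^sup>2) =
        - 2 * \<i> * complex_of_real (- Gamma (2 * a) * Im (p' x))"
      unfolding \<phi>'_def of_real_mult of_real_minus by algebra
    hence "x powr a * coulomb_series' a \<eta> x * \<rho>\<^sup>2 = - Gamma (2 * a) * Im (p' x)"
      using two_i unfolding mult_cancel_left of_real_eq_iff by blast
    thus "x powr a * coulomb_series' a \<eta> x = - k * Im (p' x)" using \<rho> by (simp add: k_def field_simps)
  qed
  have lim_Im: "((\<lambda>x. (Im (p x))\<^sup>2 + (Im (p' x))\<^sup>2) \<longlongrightarrow> \<rho>\<^sup>2) at_top"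
  proof -
    define r where "r x = Im (p' x + \<i> * p x)" for x
    have r: "(r \<longlongrightarrow> 0) at_top" unfolding r_def using tendsto_Im[OF lim_q] by simp
    have "((\<lambda>x. Re (p x) * r x) \<longlongrightarrow> 0) at_top"
    proof (rule Lim_null_comparison)
      show "((\<lambda>x. cmod (p x) * \<bar>r x\<bar>) \<longlongrightarrow> 0) at_top"
        using tendsto_mult[OF lim_p tendsto_rabs[OF r]] by simp
      show "\<forall>\<^sub>F x in at_top. norm (Re (p x) * r x) \<le> cmod (p x) * \<bar>r x\<bar>"
        by (intro always_eventually allI) (simp add: abs_mult abs_Re_le_cmod mult_right_mono)
    qed
    hence "((\<lambda>x. (cmod (p x))\<^sup>2 - 2 * (Re (p x) * r x) + (r x)\<^sup>2) \<longlongrightarrow> \<rho>\<^sup>2 - 2 * 0 + 0\<^sup>2) at_top"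
      by (intro tendsto_intros lim_p r)
    moreover have "(cmod (p x))\<^sup>2 - 2 * (Re (p x) * r x) + (r x)\<^sup>2 = (Im (p x))\<^sup>2 + (Im (p' x))\<^sup>2" for x
      unfolding cmod_power2 r_def by (simp add: power2_eq_square algebra_simps)
    ultimately show ?thesis by simp
  qed
  have "((\<lambda>x. k\<^sup>2 * ((Im (p x))\<^sup>2 + (Im (p' x))\<^sup>2)) \<longlongrightarrow> k\<^sup>2 * \<rho>\<^sup>2) at_top"
    by (intro tendsto_intros lim_Im)
  moreover have "k\<^sup>2 * \<rho>\<^sup>2 = (Gamma (2 * a) / \<rho>)\<^sup>2"
    using \<rho> by (simp add: k_def field_simps power2_eq_square)
  moreover have "\<forall>\<^sub>F x in at_top. (x powr a * coulomb_series a \<eta> x)\<^sup>2 + (x powr a * coulomb_series' a \<eta> x)\<^sup>2 =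
     k\<^sup>2 * ((Im (p x))\<^sup>2 + (Im (p' x))\<^sup>2)"
    using eventually_gt_at_top[of 0]
    by eventually_elim (simp add: rep power_mult_distrib algebra_simps)
  ultimately show ?thesis by (simp add: tendsto_cong \<rho>_def)
qed

end

section \<open>Monotone energy quotients for the Coulomb equation\<close>

text \<open>
Real solutions of the Coulomb equation on the positive half line; \<open>a\<^sup>2 - a\<close> is \<open>l (l + 1)\<close>.
\<close>

locale coulomb_equation =
  fixes a \<eta> :: real and f f' :: "real \<Rightarrow> real"
  assumes a_nonzero: "a \<noteq> 0"
    and deriv_f: "\<And>x. x > 0 \<Longrightarrow> (f has_real_derivative f' x) (at x)"
    and deriv_f': "\<And>x. x > 0 \<Longrightarrow>
          (f' has_real_derivative ((a\<^sup>2 - a) / x\<^sup>2 + 2 * \<eta> / x - 1) * f x) (at x)"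
begin

text \<open>
The equation itself would suggest the coefficient \<open>1 - 2 \<eta> / x - (a\<^sup>2 - a) / x\<^sup>2\<close>.  The one chosen here equals
\<open>(1 + (\<rho> - \<eta>) / x) (1 - (\<rho> + \<eta>) / x)\<close> whenever \<open>\<rho>\<^sup>2 = a\<^sup>2 + \<eta>\<^sup>2\<close>, and this factorization carries the argument.
\<close>

definition energy :: "real \<Rightarrow> real" where
  "energy x = (f' x)\<^sup>2 + (1 - 2 * \<eta> / x - a\<^sup>2 / x\<^sup>2) * (f x)\<^sup>2"

lemma deriv_energy:
  assumes "x > 0"
  shows "(energy has_real_derivative
           2 * a / x\<^sup>2 * ((a / x + \<eta> / a) * f x - f' x) * f x) (at x)"
proof -
  have "(energy has_real_derivative
      2 * f' x * (((a\<^sup>2 - a) / x\<^sup>2 + 2 * \<eta> / x - 1) * f x)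
      + ((2 * \<eta> / x\<^sup>2 + 2 * a\<^sup>2 / x ^ 3) * (f x)\<^sup>2
         + (1 - 2 * \<eta> / x - a\<^sup>2 / x\<^sup>2) * (2 * f x * f' x))) (at x)"
    unfolding energy_def using assms
    by (auto intro!: derivative_eq_intros deriv_f deriv_f' simp: power2_eq_square power3_eq_cube)
       (simp add: field_simps)
  also have "2 * f' x * (((a\<^sup>2 - a) / x\<^sup>2 + 2 * \<eta> / x - 1) * f x)
      + ((2 * \<eta> / x\<^sup>2 + 2 * a\<^sup>2 / x ^ 3) * (f x)\<^sup>2
         + (1 - 2 * \<eta> / x - a\<^sup>2 / x\<^sup>2) * (2 * f x * f' x)) = 2 * a / x\<^sup>2 * ((a / x + \<eta> / a) * f x - f' x) * f x"
    using assms a_nonzero by (simp add: field_simps power2_eq_square power3_eq_cube)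
  finally show ?thesis .
qed

lemma root_minus_nonzero: "\<rho>\<^sup>2 = a\<^sup>2 + \<eta>\<^sup>2 \<Longrightarrow> \<rho> - \<eta> \<noteq> 0"
  using a_nonzero by auto

text \<open>
The numerator of the derivative is a quadratic form in \<open>f\<close> and \<open>f'\<close> whose discriminant vanishes because of
\<open>(\<rho> - \<eta>) (\<rho> + \<eta>) = a\<^sup>2\<close>.  The sign of the derivative is that of \<open>\<rho> - \<eta>\<close>; both roots \<open>\<rho> = R\<close> and \<open>\<rho> = - R\<close>
will be used.
\<close>

lemma deriv_energy_quotient:
  assumes "x > 0" and \<rho>: "\<rho>\<^sup>2 = a\<^sup>2 + \<eta>\<^sup>2" and \<mu>: "1 + (\<rho> - \<eta>) / x \<noteq> 0"
  shows "((\<lambda>x. energy x / (1 + (\<rho> - \<eta>) / x)) has_real_derivative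
           ((\<rho> - \<eta>) * f' x - a * (1 + (\<rho> - \<eta>) / x) * f x)\<^sup>2 /
             ((\<rho> - \<eta>) * x\<^sup>2 * (1 + (\<rho> - \<eta>) / x)\<^sup>2)) (at x)"
proof -
  define d where "d = \<rho> - \<eta>"
  have d: "d \<noteq> 0" using root_minus_nonzero[OF \<rho>] by (simp add: d_def)
  have a2: "a\<^sup>2 = d * (d + 2 * \<eta>)" using \<rho> by (simp add: d_def power2_eq_square algebra_simps)
  define u where "u = inverse x"
  define m where "m = 1 + d * u"
  have m: "m \<noteq> 0" using \<mu> by (simp add: m_def d_def u_def divide_inverse)
  have "((\<lambda>x. energy x / (1 + d / x)) has_real_derivative
     (2 * a / x\<^sup>2 * ((a / x + \<eta> / a) * f x - f' x) * f x * (1 + d / x) - energy x * (- (d / x\<^sup>2)))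
       / ((1 + d / x) * (1 + d / x))) (at x)"
  proof (rule DERIV_divide[OF deriv_energy[OF assms(1)]])
    show "((\<lambda>x. 1 + d / x) has_real_derivative - (d / x\<^sup>2)) (at x)"
      using assms(1) by (auto intro!: derivative_eq_intros simp: power2_eq_square)
    show "1 + d / x \<noteq> 0" using m by (simp add: m_def u_def divide_inverse)
  qed
  also have "(2 * a / x\<^sup>2 * ((a / x + \<eta> / a) * f x - f' x) * f x * (1 + d / x) - energy x * (- (d / x\<^sup>2)))
       / ((1 + d / x) * (1 + d / x)) =
     (d * f' x - a * (1 + d / x) * f x)\<^sup>2 / (d * x\<^sup>2 * (1 + d / x)\<^sup>2)"
  proof -
    have "2 * a * ((a / x + \<eta> / a) * f x - f' x) * f x * (1 + d / x) + energy x * d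
        = (2 * (a\<^sup>2 * u + \<eta>) * f x - 2 * a * f' x) * f x * m
          + ((f' x)\<^sup>2 + (1 - 2 * \<eta> * u - a\<^sup>2 * u\<^sup>2) * (f x)\<^sup>2) * d"
    proof -
      have "a * (a / x + \<eta> / a) = a\<^sup>2 * u + \<eta>"
        using a_nonzero by (simp add: u_def field_simps power2_eq_square)
      hence "2 * a * ((a / x + \<eta> / a) * f x - f' x) = 2 * (a\<^sup>2 * u + \<eta>) * f x - 2 * a * f' x"
        by algebra
      thus ?thesis by (simp add: energy_def m_def u_def divide_inverse power_inverse)
    qed
    also have "\<dots> = (d * f' x - a * m * f x)\<^sup>2 / d"
    proof -
      have "((2 * (a\<^sup>2 * u + \<eta>) * f x - 2 * a * f' x) * f x * m
          + ((f' x)\<^sup>2 + (1 - 2 * \<eta> * u - a\<^sup>2 * u\<^sup>2) * (f x)\<^sup>2) * d) * d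
          = (d * f' x - a * m * f x)\<^sup>2"
        using a2 unfolding m_def by algebra
      thus ?thesis using d by (simp add: field_simps)
    qed
    finally have "2 * a * ((a / x + \<eta> / a) * f x - f' x) * f x * (1 + d / x) + energy x * d
      = (d * f' x - a * (1 + d / x) * f x)\<^sup>2 / d" by (simp add: m_def u_def divide_inverse)
    hence "(2 * a * ((a / x + \<eta> / a) * f x - f' x) * f x * (1 + d / x) + energy x * d) / (x\<^sup>2 * (1 + d / x)\<^sup>2)
      = (d * f' x - a * (1 + d / x) * f x)\<^sup>2 / (d * x\<^sup>2 * (1 + d / x)\<^sup>2)"
      by simp
    moreover have "(2 * a / x\<^sup>2 * ((a / x + \<eta> / a) * f x - f' x) * f x * (1 + d / x) - energy x * (- (d / x\<^sup>2)))
       = (2 * a * ((a / x + \<eta> / a) * f x - f' x) * f x * (1 + d / x) + energy x * d) / x\<^sup>2"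
      by (simp add: add_divide_distrib)
    ultimately show ?thesis by (simp add: power2_eq_square)
  qed
  finally show ?thesis by (simp add: d_def)
qed

text \<open>
This makes the monotonicity strict.  If the quotient is constant, the square in its derivative vanishes and
\<open>f' = k (1 + (\<rho> - \<eta>) / x) f\<close> with \<open>k = a / (\<rho> - \<eta>)\<close>.  Inserting this, the quotient becomes \<open>(k\<^sup>2 + 1) f\<^sup>2\<close>, so \<open>f\<^sup>2\<close> is
constant, \<open>f f' = 0\<close>, and the relation between \<open>f'\<close> and \<open>f\<close> leaves only \<open>f = 0\<close>.
\<close>

lemma energy_quotient_constant_imp_zero:
  assumes "0 < u" "u < v" and \<rho>: "\<rho>\<^sup>2 = a\<^sup>2 + \<eta>\<^sup>2"
    and \<mu>: "\<And>x. u < x \<Longrightarrow> x < v \<Longrightarrow> 1 + (\<rho> - \<eta>) / x \<noteq> 0"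
    and c: "\<And>x. u < x \<Longrightarrow> x < v \<Longrightarrow> energy x / (1 + (\<rho> - \<eta>) / x) = c"
    and x: "u < x" "x < v"
  shows "f x = 0"
proof -
  define d where "d = \<rho> - \<eta>"
  define k where "k = a / d"
  have d: "d \<noteq> 0" using root_minus_nonzero[OF \<rho>] by (simp add: d_def)
  have a2: "a\<^sup>2 = d * (d + 2 * \<eta>)" using \<rho> by (simp add: d_def power2_eq_square algebra_simps)
  have slope: "f' y = k * (1 + d / y) * f y" if y: "u < y" "y < v" for y
  proof -
    let ?D = "(d * f' y - a * (1 + d / y) * f y)\<^sup>2 / (d * y\<^sup>2 * (1 + d / y)\<^sup>2)"
    have "y > 0" using y assms by simp
    have "((\<lambda>x. energy x / (1 + (\<rho> - \<eta>) / x)) has_real_derivative ?D) (at y)"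
      using deriv_energy_quotient[OF \<open>y > 0\<close> \<rho> \<mu>[OF y]] by (simp add: d_def)
    moreover have "((\<lambda>x. energy x / (1 + (\<rho> - \<eta>) / x)) has_real_derivative 0) (at y)"
      by (rule has_field_derivative_transform_within_open[OF DERIV_const, where S = "{u<..<v}"])
         (use c y in auto)
    ultimately have "?D = 0" by (rule DERIV_unique)
    hence "d * f' y = a * (1 + d / y) * f y" using \<open>y > 0\<close> d \<mu>[OF y] by (simp add: d_def)
    thus ?thesis using d by (simp add: k_def field_simps)
  qed
  have sq: "(f y)\<^sup>2 * (k\<^sup>2 + 1) = c" if y: "u < y" "y < v" for y
  proof -
    have y0: "y > 0" using y assms by simp
    define w where "w = inverse y"
    define m where "m = 1 + d * w"
    have m: "m \<noteq> 0" using \<mu>[OF y] by (simp add: m_def d_def w_def divide_inverse)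
    have kd: "k\<^sup>2 * d = d + 2 * \<eta>"
      using d a2 by (simp add: k_def power_divide power2_eq_square)
    have "energy y = (k * m * f y)\<^sup>2 + (1 - 2 * \<eta> * w - a\<^sup>2 * w\<^sup>2) * (f y)\<^sup>2"
      using slope[OF y] by (simp add: energy_def m_def w_def divide_inverse power_inverse)
    also have "1 - 2 * \<eta> * w - a\<^sup>2 * w\<^sup>2 = m * (1 - (d + 2 * \<eta>) * w)"
      unfolding a2 m_def by (simp add: algebra_simps power2_eq_square)
    also have "(k * m * f y)\<^sup>2 + m * (1 - (d + 2 * \<eta>) * w) * (f y)\<^sup>2 = m * ((f y)\<^sup>2 * (k\<^sup>2 + 1))"
      unfolding kd[symmetric] m_def by (simp add: algebra_simps power2_eq_square)
    finally have "energy y / m = (f y)\<^sup>2 * (k\<^sup>2 + 1)" using m by simp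
    thus ?thesis using c[OF y] by (simp add: m_def d_def w_def divide_inverse)
  qed
  have k1: "k\<^sup>2 + 1 \<noteq> 0" by (smt (verit) zero_le_power2)
  have x0: "x > 0" using x assms by simp
  have "((\<lambda>y. (f y)\<^sup>2) has_real_derivative 2 * f x * f' x) (at x)"
    by (auto intro!: derivative_eq_intros deriv_f x0)
  moreover have "((\<lambda>y. (f y)\<^sup>2) has_real_derivative 0) (at x)"
    by (rule has_field_derivative_transform_within_open[OF DERIV_const[of "c / (k\<^sup>2 + 1)"],
          where S = "{u<..<v}"])
       (use sq k1 x in \<open>auto simp: field_simps\<close>)
  ultimately have "2 * f x * f' x = 0" by (rule DERIV_unique)
  thus ?thesis using slope[OF x] \<mu>[OF x] a_nonzero d by (auto simp: k_def d_def)
qed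

context
  fixes R :: real
  assumes R: "R\<^sup>2 = a\<^sup>2 + \<eta>\<^sup>2" "R > 0"
    and lim0: "((\<lambda>x. energy x / (1 + (R - \<eta>) / x)) \<longlongrightarrow> 0) (at_right 0)"
    and lim1: "(energy \<longlongrightarrow> 1) at_top"
    and nonzero: "\<forall>\<^sub>F x in at_right 0. f x \<noteq> 0"
begin

lemma R_bounds: "R - \<eta> > 0" "R + \<eta> > 0"
proof -
  have "\<eta>\<^sup>2 < R\<^sup>2" using R a_nonzero by simp
  hence "\<bar>\<eta>\<bar> < R" using R(2) by (metis power2_abs power2_less_imp_less less_imp_le)
  thus "R - \<eta> > 0" "R + \<eta> > 0" by auto
qed

lemma upper_factor_pos: "x > 0 \<Longrightarrow> 1 + (R - \<eta>) / x > 0"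
  using R_bounds by (simp add: add_pos_pos)

lemma energy_over_upper_mono:
  assumes "0 < x" "x \<le> y"
  shows "energy x / (1 + (R - \<eta>) / x) \<le> energy y / (1 + (R - \<eta>) / y)"
proof (rule DERIV_nonneg_imp_nondecreasing[OF assms(2)], intro exI conjI)
  fix t assume "x \<le> t" "t \<le> y"
  hence t: "t > 0" using assms by simp
  show "((\<lambda>x. energy x / (1 + (R - \<eta>) / x)) has_real_derivative
           ((R - \<eta>) * f' t - a * (1 + (R - \<eta>) / t) * f t)\<^sup>2 /
             ((R - \<eta>) * t\<^sup>2 * (1 + (R - \<eta>) / t)\<^sup>2)) (at t)"
    using upper_factor_pos[OF t] by (intro deriv_energy_quotient t R) simp
  show "((R - \<eta>) * f' t - a * (1 + (R - \<eta>) / t) * f t)\<^sup>2 /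
             ((R - \<eta>) * t\<^sup>2 * (1 + (R - \<eta>) / t)\<^sup>2) \<ge> 0"
    using R_bounds by simp
qed

text \<open>
The root \<open>\<rho> = - R\<close>: here \<open>\<rho> - \<eta>\<close> is negative.
\<close>

lemma energy_over_lower_antimono:
  assumes "R + \<eta> < x" "x \<le> y"
  shows "energy y / (1 - (R + \<eta>) / y) \<le> energy x / (1 - (R + \<eta>) / x)"
proof (rule DERIV_nonpos_imp_nonincreasing[OF assms(2)], intro exI conjI)
  fix t assume "x \<le> t" "t \<le> y"
  hence t: "t > 0" "t > R + \<eta>" using assms R_bounds by auto
  have p: "1 - (R + \<eta>) / t > 0" using t by simp
  have eq: "1 + (- R - \<eta>) / y = 1 - (R + \<eta>) / y" for y
    by (simp add: add_divide_distrib diff_divide_distrib)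
  show "((\<lambda>x. energy x / (1 - (R + \<eta>) / x)) has_real_derivative
           ((- R - \<eta>) * f' t - a * (1 - (R + \<eta>) / t) * f t)\<^sup>2 /
             ((- R - \<eta>) * t\<^sup>2 * (1 - (R + \<eta>) / t)\<^sup>2)) (at t)"
    using deriv_energy_quotient[of t "- R"] R t p unfolding eq by simp
  show "((- R - \<eta>) * f' t - a * (1 - (R + \<eta>) / t) * f t)\<^sup>2 /
             ((- R - \<eta>) * t\<^sup>2 * (1 - (R + \<eta>) / t)\<^sup>2) \<le> 0"
    using R_bounds by (intro divide_nonneg_nonpos mult_nonpos_nonneg) auto
qed

text \<open>
By monotonicity the quotient is at least its limit \<open>0\<close> at the origin; if it were \<open>0\<close> at some point, it
would be \<open>0\<close> all the way down to the origin, and \<open>f\<close> would vanish there.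
\<close>

lemma energy_pos:
  assumes x: "x > 0"
  shows "energy x > 0"
proof -
  let ?q = "\<lambda>x. energy x / (1 + (R - \<eta>) / x)"
  have nonneg: "?q y \<ge> 0" if "y > 0" for y
  proof (rule tendsto_upperbound[OF lim0])
    show "\<forall>\<^sub>F x in at_right 0. ?q x \<le> ?q y"
      using that by (auto simp: eventually_at_right_field intro!: exI[of _ y] energy_over_upper_mono)
  qed simp
  have "?q x \<noteq> 0"
  proof
    assume "?q x = 0"
    have const: "?q y = 0" if "0 < y" "y < x" for y
      using energy_over_upper_mono[of y x] nonneg[of y] \<open>?q x = 0\<close> that by linarith
    obtain b where b: "b > 0" "\<And>y. 0 < y \<Longrightarrow> y < b \<Longrightarrow> f y \<noteq> 0"
      using nonzero by (auto simp: eventually_at_right_field)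
    define y where "y = min b x / 2"
    have y: "0 < y" "y < x" "y < b" using b(1) x by (auto simp: y_def)
    have "f y = 0"
    proof (rule energy_quotient_constant_imp_zero[of "y / 2" x R 0 y])
      fix t assume t: "y / 2 < t" "t < x"
      hence "t > 0" using y by simp
      thus "1 + (R - \<eta>) / t \<noteq> 0" "?q t = 0" using upper_factor_pos const t by force+
    qed (use y R in auto)
    thus False using b y by auto
  qed
  with nonneg[OF x] have "?q x > 0" by linarith
  thus ?thesis using upper_factor_pos[OF x] by (simp add: zero_less_divide_iff)
qed

lemma quotient_tendsto_one:
  "((\<lambda>x. energy x / (1 + c / x)) \<longlongrightarrow> 1) at_top"
proof -
  have "((\<lambda>x. energy x / (1 + c / x)) \<longlongrightarrow> 1 / (1 + 0)) at_top"
    by (intro tendsto_intros lim1 real_tendsto_divide_at_top filterlim_ident) auto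
  thus ?thesis by simp
qed

text \<open>
If the increasing quotient reached its limit \<open>1\<close>, it would be constant from there on, hence \<open>f\<close> and the energy
would vanish.
\<close>

lemma energy_less_upper:
  assumes x: "x > 0"
  shows "energy x < 1 + (R - \<eta>) / x"
proof -
  let ?q = "\<lambda>x. energy x / (1 + (R - \<eta>) / x)"
  have le: "?q y \<le> 1" if "y > 0" for y
  proof (rule tendsto_lowerbound[OF quotient_tendsto_one])
    show "\<forall>\<^sub>F x in at_top. ?q y \<le> ?q x"
      using eventually_ge_at_top[of y] by eventually_elim (use that energy_over_upper_mono in auto)
  qed simp
  have "?q x \<noteq> 1"
  proof
    assume "?q x = 1"
    have const: "?q y = 1" if "x < y" for y
      using energy_over_upper_mono[of x y] le[of y] \<open>?q x = 1\<close> that x by linarith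
    have "f y = 0" if "x < y" "y < x + 2" for y
      by (rule energy_quotient_constant_imp_zero[of x "x + 2" R 1 y])
         (use that x R const upper_factor_pos in \<open>force+\<close>)
    hence z: "\<forall>y\<in>{x<..<x + 2}. f y = 0" by auto
    have "(f has_real_derivative 0) (at (x + 1))"
      by (rule has_field_derivative_transform_within_open[OF DERIV_const[of 0],
            where S = "{x<..<x + 2}"]) (use z in auto)
    hence "f' (x + 1) = 0" using deriv_f[of "x + 1"] x DERIV_unique by auto
    hence "energy (x + 1) = 0" using z by (simp add: energy_def)
    thus False using energy_pos[of "x + 1"] x by simp
  qed
  with le[OF x] have "?q x < 1" by linarith
  thus ?thesis using upper_factor_pos[OF x] by simp
qed

text \<open>
The same argument with the root \<open>- R\<close>, for which the quotient decreases to \<open>1\<close>.  Where the denominator is not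
positive, the positivity of the energy suffices.
\<close>

lemma energy_greater_lower:
  assumes x: "x > 0"
  shows "1 - (R + \<eta>) / x < energy x"
proof (cases "x \<le> R + \<eta>")
  case True
  hence "1 - (R + \<eta>) / x \<le> 0" using x by simp
  thus ?thesis using energy_pos[OF x] by simp
next
  case False
  hence xp: "R + \<eta> < x" by simp
  let ?q = "\<lambda>x. energy x / (1 - (R + \<eta>) / x)"
  have eq: "1 - (R + \<eta>) / y = 1 + (- R - \<eta>) / y" for y
    by (simp add: add_divide_distrib diff_divide_distrib)
  have p: "1 - (R + \<eta>) / y > 0" if "y \<ge> x" for y using that x xp by simp
  have lim: "(?q \<longlongrightarrow> 1) at_top" unfolding eq by (rule quotient_tendsto_one)
  have ge: "?q y \<ge> 1" if "y \<ge> x" for y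
  proof (rule tendsto_upperbound[OF lim])
    show "\<forall>\<^sub>F x in at_top. ?q x \<le> ?q y"
      using eventually_ge_at_top[of y]
      by eventually_elim (use that xp energy_over_lower_antimono in auto)
  qed simp
  have "?q x \<noteq> 1"
  proof
    assume "?q x = 1"
    have const: "?q y = 1" if "x < y" for y
      using energy_over_lower_antimono[of x y] ge[of y] \<open>?q x = 1\<close> that xp by linarith
    have "f y = 0" if "x < y" "y < x + 2" for y
      by (rule energy_quotient_constant_imp_zero[of x "x + 2" "- R" 1 y])
         (use that x R const p in \<open>force simp: eq[symmetric]\<close>)+
    hence z: "\<forall>y\<in>{x<..<x + 2}. f y = 0" by auto
    have "(f has_real_derivative 0) (at (x + 1))"
      by (rule has_field_derivative_transform_within_open[OF DERIV_const[of 0],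
            where S = "{x<..<x + 2}"]) (use z in auto)
    hence "f' (x + 1) = 0" using deriv_f[of "x + 1"] x DERIV_unique by auto
    hence "energy (x + 1) = 0" using z by (simp add: energy_def)
    thus False using energy_pos[of "x + 1"] x by simp
  qed
  with ge[OF order_refl] have "?q x > 1" by linarith
  thus ?thesis using p[of x] by (simp add: less_divide_eq)
qed

end
end

section \<open>The energy of the regular Coulomb wave function\<close>

text \<open>
The normalizing constant in terms of \<open>a = l + 1\<close>.
\<close>

definition coulomb_amp :: "real \<Rightarrow> real \<Rightarrow> real" where
  "coulomb_amp a \<eta> = 2 powr (a - 1) * exp (- pi * \<eta> / 2) * cmod (Gamma (Complex a \<eta>)) / Gamma (2 * a)"

definition coulomb_f :: "real \<Rightarrow> real \<Rightarrow> real \<Rightarrow> real" where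
  "coulomb_f a \<eta> x = coulomb_amp a \<eta> * x powr a * coulomb_series a \<eta> x"

definition coulomb_f' :: "real \<Rightarrow> real \<Rightarrow> real \<Rightarrow> real" where
  "coulomb_f' a \<eta> x = coulomb_amp a \<eta> * x powr a *
     (a / x * coulomb_series a \<eta> x + coulomb_series' a \<eta> x)"

abbreviation coulomb_energy :: "real \<Rightarrow> real \<Rightarrow> real \<Rightarrow> real" where
  "coulomb_energy a \<eta> \<equiv> coulomb_equation.energy a \<eta> (coulomb_f a \<eta>) (coulomb_f' a \<eta>)"

context
  fixes a \<eta> :: real
  assumes a: "a > -1/2" "a \<noteq> 0"
begin

lemma Gamma_nonzero: "Gamma (Complex a \<eta>) \<noteq> 0" "Gamma (2 * a) \<noteq> 0"
proof -
  have "Complex a \<eta> \<notin> \<int>\<^sub>\<le>\<^sub>0"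
  proof
    assume "Complex a \<eta> \<in> \<int>\<^sub>\<le>\<^sub>0"
    then obtain n where "Complex a \<eta> = - of_nat n" by (elim nonpos_Ints_cases')
    hence "a = - real n" by (simp add: complex_eq_iff)
    thus False using a by (cases n) auto
  qed
  thus "Gamma (Complex a \<eta>) \<noteq> 0" by (simp add: Gamma_eq_zero_iff)
  have "2 * a \<notin> \<int>\<^sub>\<le>\<^sub>0"
  proof
    assume "2 * a \<in> \<int>\<^sub>\<le>\<^sub>0"
    then obtain n where "2 * a = - of_nat n" by (elim nonpos_Ints_cases')
    thus False using a by (cases n) auto
  qed
  thus "Gamma (2 * a) \<noteq> 0" by (simp add: Gamma_eq_zero_iff)
qed

lemma coulomb_amp_nonzero: "coulomb_amp a \<eta> \<noteq> 0"
  using Gamma_nonzero by (simp add: coulomb_amp_def)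

lemma coulomb_amp_shift:
  "coulomb_amp (a + 1) \<eta> = coulomb_amp a \<eta> * (sqrt (a\<^sup>2 + \<eta>\<^sup>2) / (a * (2 * a + 1)))"
proof -
  have "Complex a \<eta> \<notin> \<int>\<^sub>\<le>\<^sub>0" using Gamma_nonzero(1) by (simp add: Gamma_eq_zero_iff)
  hence "Gamma (Complex a \<eta> + 1) = Complex a \<eta> * Gamma (Complex a \<eta>)" by (rule Gamma_plus1)
  also have "Complex a \<eta> + 1 = Complex (a + 1) \<eta>" by (simp add: complex_eq_iff)
  finally have 1: "cmod (Gamma (Complex (a + 1) \<eta>)) = sqrt (a\<^sup>2 + \<eta>\<^sup>2) * cmod (Gamma (Complex a \<eta>))"
    by (simp add: norm_mult complex_norm)
  have n: "2 * a \<notin> \<int>\<^sub>\<le>\<^sub>0" using Gamma_nonzero(2) by (simp add: Gamma_eq_zero_iff)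
  have "2 * a + 1 > 0" using a by simp
  hence n': "2 * a + 1 \<notin> \<int>\<^sub>\<le>\<^sub>0" by (auto elim!: nonpos_Ints_cases')
  have "Gamma (2 * (a + 1)) = Gamma (2 * a + 1 + 1)" by (simp add: algebra_simps)
  also have "\<dots> = (2 * a + 1) * (2 * a * Gamma (2 * a))"
    by (simp only: Gamma_plus1[OF n'] Gamma_plus1[OF n])
  finally have 2: "Gamma (2 * (a + 1)) = (2 * a + 1) * (2 * a * Gamma (2 * a))" .
  have 3: "2 powr (a + 1 - 1) = 2 * 2 powr (a - 1)" by (simp add: powr_diff)
  have rearrange: "2 * P * E * (R * g) / (c * (2 * a * G)) = P * E * g / G * (R / (a * c))"
    if "c \<noteq> 0" "G \<noteq> 0" for P E R g c G :: real
    using that a by (simp add: field_simps)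
  show ?thesis unfolding coulomb_amp_def 1 2 3
    using \<open>2 * a + 1 > 0\<close> Gamma_nonzero(2) by (intro rearrange) auto
qed

lemma coulomb_f_equation: "coulomb_equation a \<eta> (coulomb_f a \<eta>) (coulomb_f' a \<eta>)"
proof
  show "a \<noteq> 0" by (rule a)
  fix x :: real assume x: "x > 0"
  have p: "((\<lambda>x. x powr a) has_real_derivative x powr a * (a / x)) (at x)"
    using x by (auto intro!: derivative_eq_intros simp: powr_diff)
  have f: "((\<lambda>x. coulomb_amp a \<eta> * x powr a) has_real_derivative
      coulomb_amp a \<eta> * (x powr a * (a / x))) (at x)"
    by (rule DERIV_cmult[OF p])
  show "(coulomb_f a \<eta> has_real_derivative coulomb_f' a \<eta> x) (at x)"
    unfolding coulomb_f_def[abs_def] coulomb_f'_def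
    using DERIV_mult[OF f deriv_coulomb_series[OF a, of \<eta> x]] by (simp add: algebra_simps)
  have q: "((\<lambda>x. a / x) has_real_derivative - (a / x\<^sup>2)) (at x)"
    using x by (auto intro!: derivative_eq_intros simp: power2_eq_square)
  let ?s = "coulomb_series a \<eta> x" and ?s' = "coulomb_series' a \<eta> x"
  let ?s'' = "((2 * \<eta> - x) * ?s - 2 * a * ?s') / x"
  have "(coulomb_f' a \<eta> has_real_derivative
      coulomb_amp a \<eta> * (x powr a * (a / x)) * (a / x * ?s + ?s') +
      coulomb_amp a \<eta> * x powr a * ((- (a / x\<^sup>2) * ?s + a / x * ?s') + ?s'')) (at x)"
  proof -
    have "((\<lambda>x. a / x * coulomb_series a \<eta> x + coulomb_series' a \<eta> x) has_real_derivative
        (- (a / x\<^sup>2) * ?s + a / x * ?s') + ?s'') (at x)"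
      using DERIV_add[OF DERIV_mult[OF q deriv_coulomb_series[OF a, of \<eta> x]] deriv_coulomb_series'[OF a, of x \<eta>]] x
      by (simp add: mult.commute add.commute)
    from DERIV_mult[OF f this] show ?thesis
      unfolding coulomb_f'_def[abs_def] by (simp add: mult.commute)
  qed
  also have "coulomb_amp a \<eta> * (x powr a * (a / x)) * (a / x * ?s + ?s') +
      coulomb_amp a \<eta> * x powr a * ((- (a / x\<^sup>2) * ?s + a / x * ?s') + ?s'') =
      coulomb_amp a \<eta> * x powr a * ((a / x) * (a / x * ?s + ?s') + ((- (a / x\<^sup>2) * ?s + a / x * ?s') + ?s''))"
    by (simp only: algebra_simps)
  also have "(a / x) * (a / x * ?s + ?s') + ((- (a / x\<^sup>2) * ?s + a / x * ?s') + ?s'')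
     = ((a\<^sup>2 - a) / x\<^sup>2 + 2 * \<eta> / x - 1) * ?s"
    using x by (simp add: field_simps power2_eq_square)
  finally show "(coulomb_f' a \<eta> has_real_derivative
       ((a\<^sup>2 - a) / x\<^sup>2 + 2 * \<eta> / x - 1) * coulomb_f a \<eta> x) (at x)"
    by (simp add: coulomb_f_def mult_ac)
qed

text \<open>
The ladder relation of the power series factors in normalized form: the quotient of the normalizing
constants for \<open>a + 1\<close> and \<open>a\<close> absorbs the square of \<open>sqrt (a\<^sup>2 + \<eta>\<^sup>2)\<close> up to one factor.
\<close>

lemma coulomb_f_ladder:
  assumes x: "x > 0"
  shows "coulomb_f' a \<eta> x = (a / x + \<eta> / a) * coulomb_f a \<eta> x - sqrt (a\<^sup>2 + \<eta>\<^sup>2) / a * coulomb_f (a + 1) \<eta> x"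
proof -
  define R where "R = sqrt (a\<^sup>2 + \<eta>\<^sup>2)"
  have R: "R\<^sup>2 = a\<^sup>2 + \<eta>\<^sup>2" by (simp add: R_def)
  define Q where "Q = R / (a * (2 * a + 1))"
  have "2 * a + 1 \<noteq> 0" using a by auto
  hence Q: "(a\<^sup>2 + \<eta>\<^sup>2) / (a * (2 * a + 1)) = R * Q"
    unfolding Q_def R[symmetric] by (simp add: power2_eq_square)
  have s': "coulomb_series' a \<eta> x = \<eta> / a * coulomb_series a \<eta> x - R / a * Q * (x * coulomb_series (a + 1) \<eta> x)"
    using coulomb_series_shift[OF a, of \<eta> x] a unfolding Q by (simp add: field_simps)
  \<comment> \<open>the identity behind the next step, with all quotients treated as atoms\<close>
  have rearrange: "A * X * (c * s + (b * s - q * Q * (x * t))) = (c + b) * (A * X * s) - q * (A * Q * (X * x) * t)"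
    for A X c s b q t by (simp add: algebra_simps)
  have "coulomb_f' a \<eta> x = (a / x + \<eta> / a) * coulomb_f a \<eta> x -
      R / a * (coulomb_amp a \<eta> * Q * (x powr a * x) * coulomb_series (a + 1) \<eta> x)"
    unfolding coulomb_f'_def coulomb_f_def s' by (rule rearrange)
  also have "x powr a * x = x powr (a + 1)" using x by (simp add: powr_add)
  also have "coulomb_amp a \<eta> * Q = coulomb_amp (a + 1) \<eta>"
    by (simp add: coulomb_amp_shift R_def Q_def)
  finally show ?thesis by (simp add: coulomb_f_def R_def)
qed

end

text \<open>
The companion ladder relation follows by differentiating the first one and inserting the Coulomb equation.
\<close>

lemma coulomb_f_shift_deriv:
  assumes a: "a > -1/2" "a \<noteq> 0" and x: "x > 0"
  shows "coulomb_f' (a + 1) \<eta> x = sqrt (a\<^sup>2 + \<eta>\<^sup>2) / a * coulomb_f a \<eta> x - (a / x + \<eta> / a) * coulomb_f (a + 1) \<eta> x"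
proof -
  interpret f: coulomb_equation a \<eta> "coulomb_f a \<eta>" "coulomb_f' a \<eta>" by (rule coulomb_f_equation[OF a])
  have a1: "a + 1 > -1/2" "a + 1 \<noteq> 0" using a by auto
  define r where "r = sqrt (a\<^sup>2 + \<eta>\<^sup>2) / a"
  have r2: "r\<^sup>2 = 1 + (\<eta> / a)\<^sup>2" using a by (simp add: r_def power_divide add_divide_distrib)
  have r0: "r \<noteq> 0" using a by (simp add: r_def)
  define s where "s = a / x + \<eta> / a"
  have G: "coulomb_f (a + 1) \<eta> y = ((a / y + \<eta> / a) * coulomb_f a \<eta> y - coulomb_f' a \<eta> y) / r" if "y > 0" for y
  proof -
    have "coulomb_f' a \<eta> y = (a / y + \<eta> / a) * coulomb_f a \<eta> y - r * coulomb_f (a + 1) \<eta> y"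
      unfolding r_def by (rule coulomb_f_ladder[OF a that])
    thus ?thesis using r0 by simp
  qed
  let ?D = "(- (a / x\<^sup>2) * coulomb_f a \<eta> x + s * coulomb_f' a \<eta> x -
        ((a\<^sup>2 - a) / x\<^sup>2 + 2 * \<eta> / x - 1) * coulomb_f a \<eta> x) / r"
  have "((\<lambda>y. ((a / y + \<eta> / a) * coulomb_f a \<eta> y - coulomb_f' a \<eta> y) / r) has_real_derivative ?D) (at x)"
  proof (intro DERIV_cdivide DERIV_diff f.deriv_f' x)
    have "((\<lambda>y. a / y + \<eta> / a) has_real_derivative - (a / x\<^sup>2)) (at x)"
      using x by (auto intro!: derivative_eq_intros simp: power2_eq_square)
    from DERIV_mult[OF this f.deriv_f[OF x]]
    show "((\<lambda>y. (a / y + \<eta> / a) * coulomb_f a \<eta> y) has_real_derivative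
          - (a / x\<^sup>2) * coulomb_f a \<eta> x + s * coulomb_f' a \<eta> x) (at x)"
      by (simp add: s_def algebra_simps)
  qed
  hence "(coulomb_f (a + 1) \<eta> has_real_derivative ?D) (at x)"
    by (rule has_field_derivative_transform_within_open[where S = "{0<..}"]) (use G x in auto)
  moreover have "(coulomb_f (a + 1) \<eta> has_real_derivative coulomb_f' (a + 1) \<eta> x) (at x)"
    using coulomb_equation.deriv_f[OF coulomb_f_equation[OF a1] x] .
  ultimately have "coulomb_f' (a + 1) \<eta> x = ?D" by (rule DERIV_unique[rotated])
  also have "?D = r * coulomb_f a \<eta> x - s * coulomb_f (a + 1) \<eta> x"
  proof -
    have s2: "s\<^sup>2 = a\<^sup>2 / x\<^sup>2 + 2 * \<eta> / x + (\<eta> / a)\<^sup>2"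
      using a x by (simp add: s_def power2_sum power_divide)
    have f': "coulomb_f' a \<eta> x = s * coulomb_f a \<eta> x - r * coulomb_f (a + 1) \<eta> x"
      using coulomb_f_ladder[OF a x] by (simp add: s_def r_def)
    have "- (a / x\<^sup>2) * coulomb_f a \<eta> x + s * coulomb_f' a \<eta> x -
        ((a\<^sup>2 - a) / x\<^sup>2 + 2 * \<eta> / x - 1) * coulomb_f a \<eta> x =
       (s\<^sup>2 - a\<^sup>2 / x\<^sup>2 - 2 * \<eta> / x + 1) * coulomb_f a \<eta> x - s * r * coulomb_f (a + 1) \<eta> x"
      unfolding f' by (simp add: diff_divide_distrib power2_eq_square algebra_simps)
    also have "s\<^sup>2 - a\<^sup>2 / x\<^sup>2 - 2 * \<eta> / x + 1 = r\<^sup>2" by (simp add: s2 r2)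
    also have "r\<^sup>2 * coulomb_f a \<eta> x - s * r * coulomb_f (a + 1) \<eta> x =
        r * (r * coulomb_f a \<eta> x - s * coulomb_f (a + 1) \<eta> x)"
      by (simp add: power2_eq_square algebra_simps)
    finally show ?thesis using r0 by simp
  qed
  finally show ?thesis by (simp add: r_def s_def)
qed

text \<open>
With \<open>s = a / x + \<eta> / a\<close> and \<open>r = sqrt (a\<^sup>2 + \<eta>\<^sup>2) / a\<close>, the coefficient \<open>1 - 2 \<eta> / x - a\<^sup>2 / x\<^sup>2\<close> equals
\<open>r\<^sup>2 - s\<^sup>2\<close>.  By the ladder relations, the quadratic form with this coefficient takes the same value
\<open>r\<^sup>2 (F\<^sup>2 + G\<^sup>2) - 2 r s F G\<close> on the solution \<open>F\<close> for \<open>a\<close> and on the solution \<open>G\<close> for \<open>a + 1\<close>.  The energy of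
\<open>G\<close> has \<open>(a + 1)\<^sup>2\<close> in place of \<open>a\<^sup>2\<close>, which accounts for the difference.
\<close>

lemma coulomb_energy_shift:
  assumes a: "a > -1/2" "a \<noteq> 0" and x: "x > 0"
  shows "coulomb_energy a \<eta> x = coulomb_energy (a + 1) \<eta> x + (2 * a + 1) * ((coulomb_f (a + 1) \<eta> x)\<^sup>2 / x\<^sup>2)"
proof -
  have a1: "a + 1 > -1/2" "a + 1 \<noteq> 0" using a by auto
  interpret f: coulomb_equation a \<eta> "coulomb_f a \<eta>" "coulomb_f' a \<eta>" by (rule coulomb_f_equation[OF a])
  interpret g: coulomb_equation "a + 1" \<eta> "coulomb_f (a + 1) \<eta>" "coulomb_f' (a + 1) \<eta>"
    by (rule coulomb_f_equation[OF a1])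
  define r s where "r = sqrt (a\<^sup>2 + \<eta>\<^sup>2) / a" and "s = a / x + \<eta> / a"
  have r2: "r\<^sup>2 = 1 + (\<eta> / a)\<^sup>2" using a by (simp add: r_def power_divide add_divide_distrib)
  have s2: "s\<^sup>2 = a\<^sup>2 / x\<^sup>2 + 2 * \<eta> / x + (\<eta> / a)\<^sup>2"
    using a x by (simp add: s_def power2_sum power_divide)
  have c: "1 - 2 * \<eta> / x - a\<^sup>2 / x\<^sup>2 = r\<^sup>2 - s\<^sup>2" unfolding r2 s2 by simp
  have c': "1 - 2 * \<eta> / x - (a + 1)\<^sup>2 / x\<^sup>2 = r\<^sup>2 - s\<^sup>2 - (2 * a + 1) / x\<^sup>2"
    unfolding r2 s2 by (simp add: power2_sum add_divide_distrib algebra_simps)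
  have f': "coulomb_f' a \<eta> x = s * coulomb_f a \<eta> x - r * coulomb_f (a + 1) \<eta> x"
    using coulomb_f_ladder[OF a x] by (simp add: s_def r_def)
  have g': "coulomb_f' (a + 1) \<eta> x = r * coulomb_f a \<eta> x - s * coulomb_f (a + 1) \<eta> x"
    using coulomb_f_shift_deriv[OF a x] by (simp add: s_def r_def)
  show ?thesis unfolding f.energy_def g.energy_def c c' f' g'
    by (simp add: power2_eq_square algebra_simps)
qed

lemma (in coulomb_equation) square_over_square_tendsto_0:
  assumes "(energy \<longlongrightarrow> 1) at_top"
  shows "((\<lambda>x. (f x)\<^sup>2 / x\<^sup>2) \<longlongrightarrow> 0) at_top"
proof (rule Lim_null_comparison)
  have "((\<lambda>x. 1 - 2 * \<eta> / x - a\<^sup>2 / x\<^sup>2) \<longlongrightarrow> 1 - 0 - 0) at_top"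
    by (intro tendsto_intros real_tendsto_divide_at_top[OF tendsto_const] filterlim_ident
         filterlim_pow_at_top) auto
  hence "\<forall>\<^sub>F x in at_top. 1 - 2 * \<eta> / x - a\<^sup>2 / x\<^sup>2 > 1 / 2"
    by (rule order_tendstoD) auto
  thus "\<forall>\<^sub>F x in at_top. norm ((f x)\<^sup>2 / x\<^sup>2) \<le> 2 * energy x / x\<^sup>2"
  proof eventually_elim
    case (elim x)
    define c where "c = 1 - 2 * \<eta> / x - a\<^sup>2 / x\<^sup>2"
    have "1 / 2 * (f x)\<^sup>2 \<le> c * (f x)\<^sup>2"
      using elim by (intro mult_right_mono) (auto simp: c_def)
    moreover have "energy x = (f' x)\<^sup>2 + c * (f x)\<^sup>2" by (simp add: energy_def c_def)
    moreover have "(f' x)\<^sup>2 \<ge> 0" by simp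
    ultimately have "(f x)\<^sup>2 \<le> 2 * energy x" by linarith
    thus ?case by (simp add: divide_right_mono)
  qed
  show "((\<lambda>x. 2 * energy x / x\<^sup>2) \<longlongrightarrow> 0) at_top"
    by (intro real_tendsto_divide_at_top[where c = "2 * 1"] tendsto_mult tendsto_const assms filterlim_pow_at_top filterlim_ident) auto
qed

lemma coulomb_energy_limit_large:
  assumes a: "a \<ge> 1"
  shows "(coulomb_energy a \<eta> \<longlongrightarrow> 1) at_top"
proof -
  have a': "a > -1/2" "a \<noteq> 0" using a by auto
  interpret f: coulomb_equation a \<eta> "coulomb_f a \<eta>" "coulomb_f' a \<eta>" by (rule coulomb_f_equation[OF a'])
  define X Y where "X x = x powr a * coulomb_series a \<eta> x" and "Y x = x powr a * coulomb_series' a \<eta> x" for x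
  define L where "L = Gamma (2 * a) / (cmod (Gamma (Complex a \<eta>)) * (2 powr (a - 1) * exp (- (pi * \<eta> / 2))))"
  have XY: "((\<lambda>x. (X x)\<^sup>2 + (Y x)\<^sup>2) \<longlongrightarrow> L\<^sup>2) at_top"
    unfolding X_def Y_def L_def by (rule coulomb_series_amplitude[OF a])
  define c where "c = \<bar>a\<bar> + 2 * \<bar>\<eta>\<bar>"
  have small: "((\<lambda>x. (2 * a * X x * Y x - 2 * \<eta> * (X x)\<^sup>2) / x) \<longlongrightarrow> 0) at_top"
  proof (rule Lim_null_comparison)
    show "\<forall>\<^sub>F x in at_top. norm ((2 * a * X x * Y x - 2 * \<eta> * (X x)\<^sup>2) / x) \<le> c * ((X x)\<^sup>2 + (Y x)\<^sup>2) / x"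
      using eventually_gt_at_top[of 0]
    proof eventually_elim
      case (elim x)
      have "\<bar>2 * (X x * Y x)\<bar> \<le> (X x)\<^sup>2 + (Y x)\<^sup>2"
        using sum_squares_bound[of "\<bar>X x\<bar>" "\<bar>Y x\<bar>"] by (simp add: abs_mult)
      hence "\<bar>a\<bar> * \<bar>2 * (X x * Y x)\<bar> \<le> \<bar>a\<bar> * ((X x)\<^sup>2 + (Y x)\<^sup>2)" by (intro mult_left_mono) auto
      moreover have "2 * \<bar>\<eta>\<bar> * (X x)\<^sup>2 \<le> 2 * \<bar>\<eta>\<bar> * ((X x)\<^sup>2 + (Y x)\<^sup>2)" by (intro mult_left_mono) auto
      moreover have "\<bar>2 * a * X x * Y x - 2 * \<eta> * (X x)\<^sup>2\<bar> \<le> \<bar>a\<bar> * \<bar>2 * (X x * Y x)\<bar> + 2 * \<bar>\<eta>\<bar> * (X x)\<^sup>2"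
        using abs_triangle_ineq4[of "2 * a * X x * Y x" "2 * \<eta> * (X x)\<^sup>2"] by (simp add: abs_mult mult_ac)
      ultimately have "\<bar>2 * a * X x * Y x - 2 * \<eta> * (X x)\<^sup>2\<bar> \<le> c * ((X x)\<^sup>2 + (Y x)\<^sup>2)"
        unfolding c_def distrib_right by linarith
      thus ?case using elim by (simp add: divide_right_mono)
    qed
    show "((\<lambda>x. c * ((X x)\<^sup>2 + (Y x)\<^sup>2) / x) \<longlongrightarrow> 0) at_top"
      by (rule real_tendsto_divide_at_top[OF tendsto_mult[OF tendsto_const XY] filterlim_ident])
  qed
  have "((\<lambda>x. (coulomb_amp a \<eta>)\<^sup>2 * ((X x)\<^sup>2 + (Y x)\<^sup>2 + (2 * a * X x * Y x - 2 * \<eta> * (X x)\<^sup>2) / x)) \<longlongrightarrow>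
        (coulomb_amp a \<eta>)\<^sup>2 * (L\<^sup>2 + 0)) at_top"
    by (intro tendsto_mult tendsto_const tendsto_add[OF XY small])
  moreover have "(coulomb_amp a \<eta>)\<^sup>2 * (L\<^sup>2 + 0) = 1"
  proof -
    have "coulomb_amp a \<eta> * L = 1"
      using Gamma_nonzero(1)[OF a', of \<eta>] Gamma_nonzero(2)[OF a'] by (simp add: coulomb_amp_def L_def)
    thus ?thesis by (simp flip: power_mult_distrib)
  qed
  moreover have "\<forall>\<^sub>F x in at_top. coulomb_energy a \<eta> x =
      (coulomb_amp a \<eta>)\<^sup>2 * ((X x)\<^sup>2 + (Y x)\<^sup>2 + (2 * a * X x * Y x - 2 * \<eta> * (X x)\<^sup>2) / x)"
    using eventually_gt_at_top[of 0]
  proof eventually_elim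
    case (elim x)
    have ff': "coulomb_f a \<eta> x = coulomb_amp a \<eta> * X x" "coulomb_f' a \<eta> x = coulomb_amp a \<eta> * (a / x * X x + Y x)"
      by (simp_all add: coulomb_f_def coulomb_f'_def X_def Y_def algebra_simps)
    show ?case unfolding f.energy_def ff' using elim by (simp add: field_simps power2_eq_square)
  qed
  ultimately show ?thesis by (simp add: tendsto_cong)
qed

lemma coulomb_energy_limit_step:
  assumes a: "a > -1/2" "a \<noteq> 0" and lim: "(coulomb_energy (a + 1) \<eta> \<longlongrightarrow> 1) at_top"
  shows "(coulomb_energy a \<eta> \<longlongrightarrow> 1) at_top"
proof -
  have a1: "a + 1 > -1/2" "a + 1 \<noteq> 0" using a by auto
  interpret g: coulomb_equation "a + 1" \<eta> "coulomb_f (a + 1) \<eta>" "coulomb_f' (a + 1) \<eta>"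
    by (rule coulomb_f_equation[OF a1])
  have "((\<lambda>x. coulomb_energy (a + 1) \<eta> x + (2 * a + 1) * ((coulomb_f (a + 1) \<eta> x)\<^sup>2 / x\<^sup>2)) \<longlongrightarrow> 1 + (2 * a + 1) * 0) at_top"
    by (intro tendsto_intros lim g.square_over_square_tendsto_0)
  moreover have "\<forall>\<^sub>F x in at_top. coulomb_energy a \<eta> x =
      coulomb_energy (a + 1) \<eta> x + (2 * a + 1) * ((coulomb_f (a + 1) \<eta> x)\<^sup>2 / x\<^sup>2)"
    using eventually_gt_at_top[of 0] by eventually_elim (rule coulomb_energy_shift[OF a])
  ultimately show ?thesis by (simp add: tendsto_cong)
qed

text \<open>
Since \<open>a > -1/2\<close>, two steps up lead to a parameter for which the integral representation is available.
\<close>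

lemma coulomb_energy_limit:
  assumes a: "a > -1/2" "a \<noteq> 0"
  shows "(coulomb_energy a \<eta> \<longlongrightarrow> 1) at_top"
proof -
  have a1: "a + 1 > -1/2" "a + 1 \<noteq> 0" using a by auto
  have "(coulomb_energy (a + 1 + 1) \<eta> \<longlongrightarrow> 1) at_top"
    by (rule coulomb_energy_limit_large) (use a in simp)
  hence "(coulomb_energy (a + 1) \<eta> \<longlongrightarrow> 1) at_top" by (rule coulomb_energy_limit_step[OF a1])
  thus ?thesis by (rule coulomb_energy_limit_step[OF a])
qed

text \<open>
Factoring out \<open>x powr (2 * a)\<close>, the energy contains \<open>1 / x\<close> only through \<open>2 \<phi> (a \<phi>' - \<eta> \<phi>) / x\<close>, which is
bounded by the ladder relation; division by \<open>1 + (R - \<eta>) / x\<close> gains a further factor \<open>x\<close>.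
\<close>

lemma coulomb_energy_near_zero:
  fixes a \<eta> :: real
  assumes a: "a > -1/2" "a \<noteq> 0"
  defines "R \<equiv> sqrt (a\<^sup>2 + \<eta>\<^sup>2)"
  shows "((\<lambda>x. coulomb_energy a \<eta> x / (1 + (R - \<eta>) / x)) \<longlongrightarrow> 0) (at_right 0)"
proof -
  have a1: "a + 1 > -1/2" "a + 1 \<noteq> 0" using a by auto
  interpret f: coulomb_equation a \<eta> "coulomb_f a \<eta>" "coulomb_f' a \<eta>" by (rule coulomb_f_equation[OF a])
  define \<kappa> where "\<kappa> = (a\<^sup>2 + \<eta>\<^sup>2) / (a * (2 * a + 1))"
  let ?s = "coulomb_series a \<eta>" and ?s' = "coulomb_series' a \<eta>" and ?t = "coulomb_series (a + 1) \<eta>"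
  define B where "B x = (?s' x)\<^sup>2 + (?s x)\<^sup>2 - 2 * \<kappa> * ?s x * ?t x" for x
  have R: "R - \<eta> > 0"
  proof -
    have "\<bar>\<eta>\<bar> < R" unfolding R_def using a by (intro real_less_rsqrt) auto
    thus ?thesis by auto
  qed
  have "isCont B 0"
    unfolding B_def using deriv_coulomb_series[OF a, THEN DERIV_isCont] deriv_coulomb_series[OF a1, THEN DERIV_isCont]
      isCont_coulomb_series'[OF a]
    by (intro continuous_intros) auto
  hence B: "(B \<longlongrightarrow> B 0) (at_right 0)" by (auto simp: isCont_def intro: tendsto_within_subset)
  have p: "((\<lambda>x. x powr (2 * a + 1)) \<longlongrightarrow> 0 powr (2 * a + 1)) (at_right 0)"
    using a by (intro tendsto_powr' tendsto_const tendsto_ident_at)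
       (auto simp: eventually_at_right_field intro: exI[of _ 1])
  have "((\<lambda>x. (coulomb_amp a \<eta>)\<^sup>2 * x powr (2 * a + 1) * B x / (x + (R - \<eta>))) \<longlongrightarrow>
     (coulomb_amp a \<eta>)\<^sup>2 * 0 powr (2 * a + 1) * B 0 / (0 + (R - \<eta>))) (at_right 0)"
    using R by (intro tendsto_divide tendsto_mult tendsto_const B p tendsto_add tendsto_ident_at) auto
  moreover have "\<forall>\<^sub>F x in at_right 0. coulomb_energy a \<eta> x / (1 + (R - \<eta>) / x) =
      (coulomb_amp a \<eta>)\<^sup>2 * x powr (2 * a + 1) * B x / (x + (R - \<eta>))"
    unfolding eventually_at_right_field
  proof (intro exI[of _ 1] conjI allI impI)
    fix x :: real assume x: "x > 0"
    have B': "(a / x * ?s x + ?s' x)\<^sup>2 + (1 - 2 * \<eta> / x - a\<^sup>2 / x\<^sup>2) * (?s x)\<^sup>2 = B x"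
    proof -
      have "(a / x * ?s x + ?s' x)\<^sup>2 + (1 - 2 * \<eta> / x - a\<^sup>2 / x\<^sup>2) * (?s x)\<^sup>2 =
         (?s' x)\<^sup>2 + (?s x)\<^sup>2 + 2 * ?s x * (a * ?s' x - \<eta> * ?s x) / x"
        using x by (simp add: field_simps power2_eq_square)
      also have "a * ?s' x - \<eta> * ?s x = - (\<kappa> * ?t x) * x"
        using coulomb_series_shift[OF a, of \<eta> x] by (simp add: \<kappa>_def)
      finally show ?thesis using x by (simp add: B_def)
    qed
    have "coulomb_energy a \<eta> x = (coulomb_amp a \<eta>)\<^sup>2 * (x powr a)\<^sup>2 *
       ((a / x * ?s x + ?s' x)\<^sup>2 + (1 - 2 * \<eta> / x - a\<^sup>2 / x\<^sup>2) * (?s x)\<^sup>2)"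
    proof -
      have "(A * X * u)\<^sup>2 + c * (A * X * s)\<^sup>2 = A\<^sup>2 * X\<^sup>2 * (u\<^sup>2 + c * s\<^sup>2)" for A X u c s :: real
        by (simp add: power_mult_distrib algebra_simps)
      thus ?thesis unfolding f.energy_def coulomb_f_def coulomb_f'_def .
    qed
    hence "coulomb_energy a \<eta> x = (coulomb_amp a \<eta>)\<^sup>2 * (x powr a)\<^sup>2 * B x" by (simp only: B')
    moreover have xpow: "x powr (2 * a + 1) = (x powr a)\<^sup>2 * x"
    proof -
      have "x powr (a + a + 1) = (x powr a)\<^sup>2 * x"
        unfolding powr_add using x by (simp add: power2_eq_square)
      thus ?thesis by simp
    qed
    moreover have "1 + (R - \<eta>) / x = (x + (R - \<eta>)) / x" using x by (simp add: field_simps)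
    ultimately show "coulomb_energy a \<eta> x / (1 + (R - \<eta>) / x) =
      (coulomb_amp a \<eta>)\<^sup>2 * x powr (2 * a + 1) * B x / (x + (R - \<eta>))"
      using x by simp
  qed simp
  ultimately show ?thesis using a by (simp add: tendsto_cong)
qed

lemma coulomb_energy_bounds:
  fixes a \<eta> :: real
  assumes a: "a > -1/2" "a \<noteq> 0" and x: "x > 0"
  defines "R \<equiv> sqrt (a\<^sup>2 + \<eta>\<^sup>2)"
  shows "0 < coulomb_energy a \<eta> x" "coulomb_energy a \<eta> x < 1 + (R - \<eta>) / x"
    "1 - (R + \<eta>) / x < coulomb_energy a \<eta> x"
proof -
  interpret f: coulomb_equation a \<eta> "coulomb_f a \<eta>" "coulomb_f' a \<eta>" by (rule coulomb_f_equation[OF a])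
  have R: "R\<^sup>2 = a\<^sup>2 + \<eta>\<^sup>2" "R > 0" using a by (auto simp: R_def intro!: add_pos_nonneg)
  have "isCont (coulomb_series a \<eta>) 0" by (rule DERIV_isCont[OF deriv_coulomb_series[OF a]])
  hence "(coulomb_series a \<eta> \<longlongrightarrow> 1) (at_right 0)" by (auto simp: isCont_def intro: tendsto_within_subset)
  hence "\<forall>\<^sub>F x in at_right 0. coulomb_series a \<eta> x > 0" by (rule order_tendstoD) auto
  hence nz: "\<forall>\<^sub>F x in at_right 0. coulomb_f a \<eta> x \<noteq> 0"
    using eventually_at_right_less[of 0]
    by eventually_elim (use coulomb_amp_nonzero[OF a, of \<eta>] in \<open>auto simp: coulomb_f_def\<close>)
  note lims = coulomb_energy_near_zero[OF a, of \<eta>, folded R_def] coulomb_energy_limit[OF a, of \<eta>]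
  show "0 < coulomb_energy a \<eta> x" by (rule f.energy_pos[OF R lims nz x])
  show "coulomb_energy a \<eta> x < 1 + (R - \<eta>) / x" by (rule f.energy_less_upper[OF R lims nz x])
  show "1 - (R + \<eta>) / x < coulomb_energy a \<eta> x" by (rule f.energy_greater_lower[OF R lims nz x])
qed

lemma coulomb_F_eq:
  assumes "l > -3/2" "l \<noteq> -1"
  shows "coulomb_F l \<eta> = (\<lambda>x. of_real (coulomb_f (l + 1) \<eta> x))"
proof
  fix x
  show "coulomb_F l \<eta> x = of_real (coulomb_f (l + 1) \<eta> x)"
    using assms coulomb_phi_raw_eq_series[of l \<eta> x]
    by (simp add: coulomb_F_def coulomb_C_def coulomb_phi_def coulomb_f_def coulomb_amp_def coulomb_C_raw_def)
qed

lemma coulomb_F'_eq: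
  assumes "l > -3/2" "l \<noteq> -1" "x > 0"
  shows "coulomb_F' l \<eta> x = of_real (coulomb_f' (l + 1) \<eta> x)"
proof -
  interpret f: coulomb_equation "l + 1" \<eta> "coulomb_f (l + 1) \<eta>" "coulomb_f' (l + 1) \<eta>"
    using assms by (intro coulomb_f_equation) auto
  have "(coulomb_F l \<eta> has_vector_derivative of_real (coulomb_f' (l + 1) \<eta> x)) (at x)"
    unfolding coulomb_F_eq[OF assms(1,2)] by (intro has_vector_derivative_of_real f.deriv_f assms)
  thus ?thesis unfolding coulomb_F'_def by (rule vector_derivative_at)
qed

theorem theorem2p1:
  fixes l \<eta> :: real
  assumes "l > -3/2"
    and "\<eta> \<noteq> 0 \<Longrightarrow> l \<noteq> -1"
    and "\<eta> + sqrt ((l + 1)\<^sup>2 + \<eta>\<^sup>2) > 0"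
  shows "(\<forall>x > \<eta> + sqrt ((l + 1)\<^sup>2 + \<eta>\<^sup>2).
            (cmod (coulomb_F l \<eta> x))\<^sup>2 < x / (x - \<eta> - sqrt ((l + 1)\<^sup>2 + \<eta>\<^sup>2)) \<and>
            (cmod (coulomb_F' l \<eta> x))\<^sup>2 < 1 + (sqrt ((l + 1)\<^sup>2 + \<eta>\<^sup>2) - \<eta>) / x) \<and>
         (\<forall>\<beta> > 0. coulomb_F' l \<eta> \<beta> = 0 \<longrightarrow>
            (cmod (coulomb_F l \<eta> \<beta>))\<^sup>2 > \<beta> / (\<beta> - \<eta> + sqrt ((l + 1)\<^sup>2 + \<eta>\<^sup>2))) \<and>
         (\<forall>\<alpha> > 0. coulomb_F l \<eta> \<alpha> = 0 \<longrightarrow>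
            (cmod (coulomb_F' l \<eta> \<alpha>))\<^sup>2 > 1 - (sqrt ((l + 1)\<^sup>2 + \<eta>\<^sup>2) + \<eta>) / \<alpha>)"
proof -
  have l: "l \<noteq> -1" using assms(2,3) by (cases "\<eta> = 0") auto
  define a where "a = l + 1"
  define R where "R = sqrt ((l + 1)\<^sup>2 + \<eta>\<^sup>2)"
  have a: "a > -1/2" "a \<noteq> 0" using assms(1) l by (auto simp: a_def)
  interpret f: coulomb_equation a \<eta> "coulomb_f a \<eta>" "coulomb_f' a \<eta>" by (rule coulomb_f_equation[OF a])
  have R2: "R\<^sup>2 = a\<^sup>2 + \<eta>\<^sup>2" by (simp add: R_def a_def)
  have R\<eta>: "R - \<eta> > 0"
  proof -
    have "\<bar>\<eta>\<bar> < R" unfolding R_def using l by (intro real_less_rsqrt) auto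
    thus ?thesis by auto
  qed
  define p m where "p x = 1 - (R + \<eta>) / x" and "m x = 1 + (R - \<eta>) / x" for x
  note bounds = coulomb_energy_bounds[OF a, of _ \<eta>, folded R_def[folded a_def] p_def m_def]
  have m_pos: "m x > 0" if "x > 0" for x using that R\<eta> by (simp add: m_def add_pos_pos)
  have energy: "coulomb_energy a \<eta> x = (coulomb_f' a \<eta> x)\<^sup>2 + p x * m x * (coulomb_f a \<eta> x)\<^sup>2" if x: "x > 0" for x
  proof -
    have "p x * m x = 1 - 2 * \<eta> / x - (R\<^sup>2 - \<eta>\<^sup>2) / x\<^sup>2"
      using x by (simp add: p_def m_def field_simps power2_eq_square)
    thus ?thesis by (simp add: f.energy_def R2)
  qed
  have F: "(cmod (coulomb_F l \<eta> x))\<^sup>2 = (coulomb_f a \<eta> x)\<^sup>2" for x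
    by (simp add: coulomb_F_eq[OF assms(1) l] a_def)
  have F': "(cmod (coulomb_F' l \<eta> x))\<^sup>2 = (coulomb_f' a \<eta> x)\<^sup>2" if "x > 0" for x
    using that by (simp add: coulomb_F'_eq[OF assms(1) l] a_def)
  show ?thesis unfolding R_def[symmetric]
  proof (intro conjI allI impI)
    fix x assume x: "\<eta> + R < x"
    hence x0: "x > 0" using assms(3) by (simp add: R_def)
    have p: "p x > 0" using x x0 by (simp add: p_def)
    have E: "(coulomb_f' a \<eta> x)\<^sup>2 + p x * m x * (coulomb_f a \<eta> x)\<^sup>2 < m x"
      using bounds(2)[OF x0] energy[OF x0] by simp
    have "m x * (p x * (coulomb_f a \<eta> x)\<^sup>2) < m x * 1"
      using E by (smt (verit) mult.assoc mult.commute mult.right_neutral zero_le_power2)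
    hence "(coulomb_f a \<eta> x)\<^sup>2 < 1 / p x" using m_pos[OF x0] p by (simp add: field_simps)
    also have "1 / p x = x / (x - \<eta> - R)" using x0 x by (simp add: p_def field_simps)
    finally show "(cmod (coulomb_F l \<eta> x))\<^sup>2 < x / (x - \<eta> - R)" by (simp add: F)
    have "p x * m x * (coulomb_f a \<eta> x)\<^sup>2 \<ge> 0" using p m_pos[OF x0] by simp
    thus "(cmod (coulomb_F' l \<eta> x))\<^sup>2 < 1 + (R - \<eta>) / x"
      using E F'[OF x0] by (simp add: m_def)
  next
    fix \<beta> :: real assume \<beta>: "\<beta> > 0" "coulomb_F' l \<eta> \<beta> = 0"
    have E: "coulomb_energy a \<eta> \<beta> = p \<beta> * (m \<beta> * (coulomb_f a \<eta> \<beta>)\<^sup>2)"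
      using energy[OF \<beta>(1)] F'[OF \<beta>(1)] \<beta>(2) by simp
    have mf: "m \<beta> * (coulomb_f a \<eta> \<beta>)\<^sup>2 \<ge> 0" using m_pos[OF \<beta>(1)] by simp
    have p: "p \<beta> > 0"
      using bounds(1)[OF \<beta>(1)] mf unfolding E by (simp add: zero_less_mult_iff)
    have "p \<beta> * 1 < p \<beta> * (m \<beta> * (coulomb_f a \<eta> \<beta>)\<^sup>2)"
      using bounds(3)[OF \<beta>(1)] unfolding E by simp
    hence "1 / m \<beta> < (coulomb_f a \<eta> \<beta>)\<^sup>2" using p m_pos[OF \<beta>(1)] by (simp add: field_simps)
    also have "1 / m \<beta> = \<beta> / (\<beta> - \<eta> + R)" using \<beta>(1) R\<eta> by (simp add: m_def field_simps)
    finally show "(cmod (coulomb_F l \<eta> \<beta>))\<^sup>2 > \<beta> / (\<beta> - \<eta> + R)" by (simp add: F)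
  next
    fix \<alpha> :: real assume \<alpha>: "\<alpha> > 0" "coulomb_F l \<eta> \<alpha> = 0"
    have "coulomb_energy a \<eta> \<alpha> = (coulomb_f' a \<eta> \<alpha>)\<^sup>2"
      using energy[OF \<alpha>(1)] F[of \<alpha>] \<alpha>(2) by simp
    thus "(cmod (coulomb_F' l \<eta> \<alpha>))\<^sup>2 > 1 - (R + \<eta>) / \<alpha>"
      using bounds(3)[OF \<alpha>(1)] F'[OF \<alpha>(1)] by (simp add: p_def)
  qed
qed

end
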